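(* Let $Q(x)=\prod_{j=1}^\infty (1-x^j)^{-j}=1+\sum_{n\ge 1} q(n)x^n$, so that $q(n)$ is the number of plane partitions of $n$. Let $\{d_n\}_{n\ge1}$ be a sequence satisfying $$d_n=\left(\frac{2\zeta(3)}{n}\right)^{1/3}-\frac{1}{36n}+O(n^{-1-\beta}),\qquad n\to\infty,$$ for some fixed constant $\beta>0$, and put $r_n=e^{-d_n}$ and $\delta_n=d_n^{5/3}/\log n$. Let $F(x)$ be a function analytic in the unit disk $|x|<1$ satisfying: (A) $\displaystyle\lim_{n\to\infty}\frac{F(r_n e^{i\theta})}{F(r_n)}=1$ uniformly for $|\theta|\le \delta_n$; (B) there exist constants $C>0$ and $\eta\in(0,2/3)$ such that $F(x)=O\big(e^{C/(1-|x|)^{\eta}}\big)$ as $|x|\to 1$. Then there is a constant $c>0$ such that, as $n\to\infty$, $$\frac{1}{q(n)}[x^n]\,Q(x)F(x)=F(e^{-d_n})(1+o(1))+O\big(e^{-c n^{2/9}/\log^2 n}\big).$$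
   Context: $\zeta$ denotes the Riemann zeta function, and $[x^n]G(x)$ denotes the coefficient of $x^n$ in the power series $G(x)$. A plane partition of $n$ is an array $(\omega_{h,j})_{h,j\ge1}$ of non-negative integers with $\sum_{h,j}\omega_{h,j}=n$ and $\omega_{h,j}\ge\omega_{h+1,j}$, $\omega_{h,j}\ge\omega_{h,j+1}$ for all $h,j$. *)

theory Defs
  imports "HOL-Complex_Analysis.Complex_Analysis" "HOL-Library.Landau_Symbols"
begin

text \<open>The Dirichlet series of the Riemann zeta function; it represents \<open>\<zeta>(s)\<close> for \<open>s > 1\<close> only,
  which covers the value \<open>\<zeta>(3)\<close> used here.\<close>
definition zeta :: "real \<Rightarrow> real" where
  "zeta s = (\<Sum>n. 1 / real (Suc n) powr s)"

text \<open>\<open>[x\<^sup>n] G(x)\<close> for a function \<open>G\<close> holomorphic near \<open>0\<close>.\<close>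
definition ps_coeff :: "nat \<Rightarrow> (complex \<Rightarrow> complex) \<Rightarrow> complex" where
  "ps_coeff n G = fps_nth (fps_expansion G 0) n"

text \<open>The infinite product converges for \<open>|x| < 1\<close>; the values elsewhere are irrelevant.
  The index is shifted, since \<open>prodinf\<close> starts at \<open>0\<close>.\<close>
definition Q :: "complex \<Rightarrow> complex" where
  "Q x = (\<Prod>j. inverse ((1 - x ^ Suc j) ^ Suc j))"

definition q :: "nat \<Rightarrow> complex" where
  "q n = ps_coeff n Q"

end

theory Submission
  imports Defs "HOL-Probability.Probability" "HOL-Real_Asymp.Real_Asymp"
begin

text \<open>The coefficients are Cauchy integrals over the circle of radius \<open>e\<^sup>-\<^sup>d\<close> with \<open>d = d\<^sub>n\<close>, in the scaled
  angle \<open>\<theta> = d\<^sup>2 u\<close>. Since \<open>log Q(x) = \<Sum>\<^sub>k x\<^sup>k / (k (1 - x\<^sup>k)\<^sup>2)\<close>, comparing only the real part of the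
  \<open>k = 1\<close> summand with its value on the positive axis gives
  \<open>|Q(e\<^sup>-\<^sup>d\<^sup>+\<^sup>i\<^sup>\<theta>)| \<le> Q(e\<^sup>-\<^sup>d) exp(- \<theta>\<^sup>2 / (72 d\<^sup>2 (d\<^sup>2 + \<theta>\<^sup>2)))\<close> on the whole circle. This bound dominates
  the scaled integrand and makes the part \<open>|\<theta>| > \<delta>\<^sub>n\<close> as small as \<open>exp(- c n\<^bsup>2/9\<^esup> / log\<^sup>2 n)\<close>, which
  beats the growth of \<open>F\<close> because \<open>\<eta>/3 < 2/9\<close>. A Taylor expansion of \<open>log Q\<close> in \<open>\<theta>\<close> shows that
  \<open>Q(e\<^sup>-\<^sup>d\<^sup>+\<^sup>i\<^sup>\<theta>) e\<^sup>-\<^sup>i\<^sup>n\<^sup>\<theta> / Q(e\<^sup>-\<^sup>d)\<close> tends to \<open>exp(- 3 \<zeta>(3) u\<^sup>2)\<close>, because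
  \<open>2 \<zeta>(3) / d - n d\<^sup>2 \<rightarrow> 0\<close>. By dominated convergence \<open>q(n)\<close> is then of the exact order
  \<open>e\<^sup>n\<^sup>d Q(e\<^sup>-\<^sup>d) d\<^sup>2\<close>, which bounds the contribution of \<open>F - F(e\<^sup>-\<^sup>d)\<close> on \<open>|\<theta>| \<le> \<delta>\<^sub>n\<close>.\<close>

subsection \<open>The logarithm of the generating function\<close>

text \<open>The summand of index k + 1 in the series of log Q. In later estimates the dominant
  summand is therefore \<open>log_term 0\<close>, and \<open>Suc k\<close> plays the role of
  k.\<close>

definition log_term :: "nat \<Rightarrow> complex \<Rightarrow> complex" where
  "log_term k x = x ^ Suc k / (of_nat (Suc k) * (1 - x ^ Suc k)\<^sup>2)"

lemma sums_of_nat_mult_power: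
  fixes y :: "'a :: {real_normed_field, banach}"
  assumes "norm y < 1"
  shows "(\<lambda>j. of_nat (Suc j) * y ^ Suc j) sums (y / (1 - y)\<^sup>2)"
  using sums_mult[OF geometric_deriv_sums[OF assms], of y] by (simp add: mult_ac)

lemma norm_power_Suc_less_one:
  fixes x :: "'a :: real_normed_div_algebra"
  assumes "norm x < 1"
  shows "norm (x ^ Suc k) < 1"
  using power_decreasing[of 1 "Suc k" "norm x"] assms by (simp add: norm_power norm_mult)

lemma log_term_sums:
  assumes "norm x < 1"
  shows "(\<lambda>j. of_nat (Suc j) / of_nat (Suc k) * x ^ (Suc k * Suc j)) sums log_term k x"
proof -
  from sums_mult[OF sums_of_nat_mult_power[OF norm_power_Suc_less_one[OF assms, of k]], of "1 / of_nat (Suc k)"]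
  show ?thesis
    unfolding log_term_def power_mult by (simp add: mult_ac)
qed

text \<open>A geometric majorant, uniform on the closed disk of radius \<open>\<rho>\<close>: the
  denominator is bounded below by its value for k = 0 on the positive axis. It serves both absolute
  summability and the Weierstrass M-test.\<close>

lemma norm_log_term_le:
  assumes "norm x \<le> \<rho>" "\<rho> < 1"
  shows "norm (log_term k x) \<le> \<rho> ^ Suc k / (1 - \<rho>)\<^sup>2"
proof -
  have \<rho>: "0 \<le> \<rho>" using assms(1) norm_ge_zero order_trans by blast
  have p: "norm x ^ Suc k \<le> \<rho> ^ Suc k" using assms by (intro power_mono) auto
  have p2: "\<rho> ^ Suc k \<le> \<rho>"
    using power_decreasing[of 1 "Suc k" \<rho>] \<rho> assms(2) by simp
  have "1 - \<rho> \<le> 1 - norm x ^ Suc k" using p p2 by linarith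
  also have "\<dots> \<le> norm (1 - x ^ Suc k)"
    by (metis norm_one norm_power norm_triangle_ineq2)
  finally have "(1 - \<rho>)\<^sup>2 \<le> (norm (1 - x ^ Suc k))\<^sup>2"
    using assms by (intro power_mono) auto
  also have "\<dots> \<le> real (Suc k) * (norm (1 - x ^ Suc k))\<^sup>2"
    using mult_right_mono[of 1 "real (Suc k)" "(norm (1 - x ^ Suc k))\<^sup>2"] by simp
  finally have d: "(1 - \<rho>)\<^sup>2 \<le> real (Suc k) * (norm (1 - x ^ Suc k))\<^sup>2" .
  have "norm (log_term k x) = norm x ^ Suc k / (real (Suc k) * (norm (1 - x ^ Suc k))\<^sup>2)"
    unfolding log_term_def norm_divide norm_mult norm_power norm_of_nat ..
  also have "\<dots> \<le> \<rho> ^ Suc k / (1 - \<rho>)\<^sup>2"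
    using p d assms \<rho> by (intro frac_le) auto
  finally show ?thesis .
qed

lemma summable_power_Suc_divide:
  fixes \<rho> :: real
  assumes "0 \<le> \<rho>" "\<rho> < 1"
  shows "summable (\<lambda>k. \<rho> ^ Suc k / c)"
  using assms by (intro summable_divide) (subst summable_Suc_iff, intro summable_geometric, simp)

lemma summable_norm_log_term:
  assumes "norm x < 1"
  shows "summable (\<lambda>k. norm (log_term k x))"
proof (rule summable_comparison_test'[where N = 0])
  show "summable (\<lambda>k. norm x ^ Suc k / (1 - norm x)\<^sup>2)"
    using assms by (intro summable_power_Suc_divide) auto
  show "norm (norm (log_term k x)) \<le> norm x ^ Suc k / (1 - norm x)\<^sup>2" for k
    using norm_log_term_le[of x "norm x" k] assms by simp
qed

text \<open>The norms of the entries are the same double series at the real point |x|, whose inner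
  sums are again values of \<open>log_term\<close> and so have a geometric majorant. Unordered
  summability then permits summing in either order.\<close>

lemma has_sum_log_Q:
  assumes x: "norm x < 1"
  shows "((\<lambda>(k,j). of_nat (Suc j) / of_nat (Suc k) * x ^ (Suc k * Suc j))
           has_sum (\<Sum>k. log_term k x)) (UNIV \<times> UNIV)"
    (is "(?f has_sum _) _")
proof -
  define \<rho> where "\<rho> = norm x"
  have \<rho>: "0 \<le> \<rho>" "\<rho> < 1" using x by (auto simp: \<rho>_def)
  define g where "g = (\<lambda>k. Re (log_term k (of_real \<rho>)))"
  have g: "((\<lambda>j. norm (?f (k, j))) has_sum g k) UNIV" for k
  proof (rule sums_nonneg_imp_has_sum)
    have "norm (complex_of_real \<rho>) < 1" using \<rho> by simp
    from sums_Re[OF log_term_sums[OF this, of k]]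
    have "(\<lambda>j. Re (of_real (real (Suc j) / real (Suc k) * \<rho> ^ (Suc k * Suc j)))) sums g k"
      unfolding g_def of_real_mult of_real_divide of_real_power of_real_of_nat_eq .
    then show "(\<lambda>j. norm (?f (k, j))) sums g k"
      unfolding case_prod_conv norm_mult norm_divide norm_power norm_of_nat \<rho>_def[symmetric]
        Re_complex_of_real .
  qed auto
  have "summable (\<lambda>k. norm (g k))"
    using \<rho> norm_log_term_le[of "of_real \<rho>" \<rho>] unfolding g_def
    by (intro summable_comparison_test'[where N = 0 and f = "\<lambda>k. norm (g k)" for g,
          OF summable_power_Suc_divide[OF \<rho>, of "(1 - \<rho>)\<^sup>2"]])
       (auto intro: order_trans[OF abs_Re_le_cmod])
  then have "g summable_on UNIV"
    by (rule norm_summable_imp_summable_on)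
  with g have "(\<lambda>p. norm (?f p)) summable_on (UNIV \<times> UNIV)"
    by (intro summable_on_SigmaI[where g = g]) auto
  then have "?f summable_on (UNIV \<times> UNIV)"
    by (rule abs_summable_summable)
  then obtain S where S: "(?f has_sum S) (UNIV \<times> UNIV)"
    by (auto simp: summable_on_def)
  have "((\<lambda>k. log_term k x) has_sum S) UNIV"
  proof (rule has_sum_SigmaD[OF S])
    fix k
    have "summable (\<lambda>j. norm (?f (k, j)))"
      by (rule sums_summable[OF has_sum_imp_sums[OF g]])
    then show "((\<lambda>j. ?f (k, j)) has_sum log_term k x) UNIV"
      by (rule norm_summable_imp_has_sum) (use log_term_sums[OF x, of k] in simp)
  qed
  then have "S = (\<Sum>k. log_term k x)"
    by (rule sums_unique[OF has_sum_imp_sums])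
  with S show ?thesis by simp
qed

text \<open>Summing the double series over the other index first turns each row into a logarithm
  series, namely that of one factor of the product. Exponentiating partial sums gives the partial
  products.\<close>

lemma Q_eq_exp:
  assumes x: "norm x < 1"
  shows "Q x = exp (\<Sum>k. log_term k x)"
proof -
  define l where "l = (\<lambda>j. - (of_nat (Suc j) * ln (1 - x ^ Suc j)))"
  have nx: "norm (x ^ Suc j) < 1" for j
    by (rule norm_power_Suc_less_one[OF x])
  have nz: "1 - x ^ Suc j \<noteq> 0" for j
    using nx[of j] by auto
  have sw: "((\<lambda>(j,k). of_nat (Suc j) / of_nat (Suc k) * x ^ (Suc k * Suc j))
           has_sum (\<Sum>k. log_term k x)) (UNIV \<times> UNIV)" (is "(?f has_sum _) _")
    using has_sum_log_Q[OF x] by (subst has_sum_swap) simp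
  have "(l has_sum (\<Sum>k. log_term k x)) UNIV"
  proof (rule has_sum_SigmaD[OF sw])
    fix j
    have "(\<lambda>n. - ((x ^ Suc j) ^ n) / of_nat n) sums ln (1 - x ^ Suc j)"
      using Ln_series'[of "- (x ^ Suc j)"] nx[of j] by simp
    then have "(\<lambda>n. - ((x ^ Suc j) ^ Suc n) / of_nat (Suc n)) sums ln (1 - x ^ Suc j)"
      by (subst sums_Suc_iff) simp
    from sums_mult[OF this, of "- of_nat (Suc j)"]
    have "(\<lambda>k. - of_nat (Suc j) * (- ((x ^ Suc j) ^ Suc k) / of_nat (Suc k))) sums l j"
      unfolding l_def minus_mult_left .
    moreover have "- of_nat (Suc j) * (- ((x ^ Suc j) ^ Suc k) / of_nat (Suc k)) = ?f (j, k)" for k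
      by (simp add: power_mult[symmetric] mult.commute del: power_Suc of_nat_Suc)
    ultimately have s: "(\<lambda>k. ?f (j, k)) sums l j"
      by (simp only:)
    have "summable (\<lambda>k. norm (x ^ Suc j) ^ Suc k / (1 / real (Suc j)))"
      using nx by (intro summable_power_Suc_divide) auto
    then have "summable (\<lambda>k. norm (?f (j, k)))"
    proof (rule summable_comparison_test'[where N = 0])
      fix k :: nat
      have "norm (?f (j, k)) = real (Suc j) / real (Suc k) * norm (x ^ Suc j) ^ Suc k"
        by (simp add: norm_mult norm_divide norm_power power_mult[symmetric] mult.commute
              del: power_Suc of_nat_Suc)
      also have "\<dots> \<le> real (Suc j) * norm (x ^ Suc j) ^ Suc k"
        by (intro mult_right_mono) (auto simp: field_simps)
      finally show "norm (norm (?f (j, k))) \<le> norm (x ^ Suc j) ^ Suc k / (1 / real (Suc j))"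
        by (simp add: mult_ac del: power_Suc of_nat_Suc)
    qed
    then show "((\<lambda>k. ?f (j, k)) has_sum l j) UNIV"
      using s by (rule norm_summable_imp_has_sum)
  qed
  then have "l sums (\<Sum>k. log_term k x)"
    by (rule has_sum_imp_sums)
  then have lim: "(\<lambda>n. exp (\<Sum>j<n. l j)) \<longlonglongrightarrow> exp (\<Sum>k. log_term k x)"
    unfolding sums_def by (rule tendsto_exp)
  have "exp (l j) = inverse ((1 - x ^ Suc j) ^ Suc j)" for j
    using nz[of j] by (simp add: l_def exp_minus exp_of_nat_mult del: power_Suc of_nat_Suc)
  then have lim: "(\<lambda>n. \<Prod>j<n. inverse ((1 - x ^ Suc j) ^ Suc j)) \<longlonglongrightarrow> exp (\<Sum>k. log_term k x)"
    using lim by (simp add: exp_sum del: power_Suc)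
  have inz: "inverse ((1 - x ^ Suc j) ^ Suc j) \<noteq> 0" for j
    using nz[of j] by (simp del: power_Suc)
  \<comment> \<open>The limit of the partial products is an exponential, hence nonzero, as
    convergence of an infinite product demands.\<close>
  have cp: "convergent_prod (\<lambda>j. inverse ((1 - x ^ Suc j) ^ Suc j))"
    using lim inz LIMSEQ_lessThan_iff_atMost[of "\<lambda>I. \<Prod>j\<in>I. inverse ((1 - x ^ Suc j) ^ Suc j)"]
    by (subst convergent_prod_iff_nz_lim) auto
  show ?thesis
    unfolding Q_def prodinf_eq_lim'[OF cp inz] using lim by (rule limI)
qed

lemma holomorphic_Q: "Q holomorphic_on ball 0 1"
proof -
  have "(\<lambda>x. \<Sum>k. log_term k x) holomorphic_on ball 0 1"
  proof (rule holomorphic_uniform_sequence)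
    show "(\<lambda>x. \<Sum>k<n. log_term k x) holomorphic_on ball 0 1" for n
    proof (intro holomorphic_on_sum)
      fix k assume "k \<in> {..<n}"
      have "1 - x ^ Suc k \<noteq> 0" if "norm x < 1" for x :: complex
        using norm_power_Suc_less_one[OF that, of k] by auto
      then show "log_term k holomorphic_on ball 0 1"
        unfolding log_term_def
        by (intro holomorphic_intros) (auto simp del: power_Suc of_nat_Suc)
    qed
    fix x :: complex assume x: "x \<in> ball 0 1"
    \<comment> \<open>Halfway between |x| and 1, so the closed ball of radius
      \<open>\<rho> - norm x\<close> about x stays inside the disk of radius \<open>\<rho>\<close>,
      where one majorant works.\<close>
    define \<rho> where "\<rho> = (1 + norm x) / 2"
    have \<rho>: "0 \<le> \<rho>" "\<rho> < 1" "norm x < \<rho>" using x by (auto simp: \<rho>_def field_simps)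
    have le: "norm y \<le> \<rho>" if "y \<in> cball x (\<rho> - norm x)" for y
      using that norm_triangle_ineq2[of y x] by (auto simp: dist_norm norm_minus_commute)
    have "uniform_limit (cball x (\<rho> - norm x)) (\<lambda>n x. \<Sum>k<n. log_term k x)
            (\<lambda>x. \<Sum>k. log_term k x) sequentially"
      using le \<rho> by (intro Weierstrass_m_test[where M = "\<lambda>k. \<rho> ^ Suc k / (1 - \<rho>)\<^sup>2"]
          norm_log_term_le summable_power_Suc_divide) auto
    moreover have "cball x (\<rho> - norm x) \<subseteq> ball 0 1"
      using le \<rho> by (force simp: dist_norm)
    ultimately show "\<exists>d>0. cball x d \<subseteq> ball 0 1 \<and>
        uniform_limit (cball x d) (\<lambda>n x. \<Sum>k<n. log_term k x) (\<lambda>x. \<Sum>k. log_term k x) sequentially"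
      using \<rho> by (intro exI[of _ "\<rho> - norm x"]) auto
  qed auto
  then have "(\<lambda>x. exp (\<Sum>k. log_term k x)) holomorphic_on ball 0 1"
    by (intro holomorphic_intros)
  then show ?thesis
    by (rule holomorphic_transform) (simp add: Q_eq_exp)
qed

section \<open>Decay of |Q| along a circle away from the positive axis\<close>

lemma norm_log_term_le_of_norm:
  assumes "norm x < 1"
  shows "norm (log_term k x) \<le> Re (log_term k (of_real (norm x)))"
proof -
  define r where "r = norm x"
  have r: "0 \<le> r" "r ^ Suc k < 1"
    using norm_power_Suc_less_one[OF assms, of k] by (auto simp: r_def norm_power norm_mult)
  \<comment> \<open>On a circle the denominator is smallest on the positive axis, while the
    numerator has constant modulus.\<close>
  have "1 - r ^ Suc k \<le> norm (1 - x ^ Suc k)"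
    unfolding r_def by (metis norm_one norm_power norm_triangle_ineq2)
  then have "(1 - r ^ Suc k)\<^sup>2 \<le> (norm (1 - x ^ Suc k))\<^sup>2"
    using r by (intro power_mono) auto
  then have "r ^ Suc k / (real (Suc k) * (norm (1 - x ^ Suc k))\<^sup>2)
      \<le> r ^ Suc k / (real (Suc k) * (1 - r ^ Suc k)\<^sup>2)"
    using r by (intro frac_le mult_left_mono mult_pos_pos) (auto simp del: power_Suc of_nat_Suc)
  moreover have "norm (log_term k x) = r ^ Suc k / (real (Suc k) * (norm (1 - x ^ Suc k))\<^sup>2)"
    unfolding log_term_def norm_divide norm_mult norm_power norm_of_nat r_def ..
  moreover have "log_term k (of_real r) = of_real (r ^ Suc k / (real (Suc k) * (1 - r ^ Suc k)\<^sup>2))"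
    unfolding log_term_def by simp
  ultimately show ?thesis
    unfolding r_def[symmetric] by (simp only: Re_complex_of_real)
qed

lemma Q_nonzero: "norm x < 1 \<Longrightarrow> Q x \<noteq> 0"
  by (simp add: Q_eq_exp)

text \<open>The constant 1/16 is crude on purpose. For |x| up to 2 the cubic Taylor polynomial has
  error at most x^4/24, hence at most x^2/6, which leaves x^2/3. Beyond 2 the cosine is negative and
  x^2 is at most 16.\<close>

lemma one_minus_cos_ge:
  fixes \<theta> :: real
  assumes "\<bar>\<theta>\<bar> \<le> pi"
  shows "\<theta>\<^sup>2 / 16 \<le> 1 - cos \<theta>"
proof (cases "\<bar>\<theta>\<bar> \<le> 2")
  case True
  have "\<bar>Re (iexp \<theta> - (\<Sum>k\<le>3. (\<i> * \<theta>) ^ k / fact k))\<bar> \<le> \<bar>\<theta>\<bar> ^ 4 / fact 4"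
    using iexp_approx1[of \<theta> 3] by (intro order_trans[OF abs_Re_le_cmod]) (simp add: numeral_eq_Suc)
  also have "Re (iexp \<theta> - (\<Sum>k\<le>3. (\<i> * \<theta>) ^ k / fact k)) = cos \<theta> - 1 + \<theta>\<^sup>2 / 2"
    by (simp add: cis_conv_exp[symmetric] numeral_eq_Suc)
  finally have "\<bar>cos \<theta> - 1 + \<theta>\<^sup>2 / 2\<bar> \<le> \<theta> ^ 4 / 24"
    by (simp add: fact_numeral)
  moreover have "\<theta> ^ 4 \<le> 4 * \<theta>\<^sup>2"
  proof -
    have "\<theta>\<^sup>2 \<le> 4" using power_mono[OF True, of 2] by simp
    then have "\<theta>\<^sup>2 * \<theta>\<^sup>2 \<le> 4 * \<theta>\<^sup>2" by (intro mult_right_mono) auto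
    then show ?thesis by (simp add: power2_eq_square numeral_eq_Suc mult_ac)
  qed
  ultimately show ?thesis
    using zero_le_power2[of \<theta>] by linarith
next
  case False
  have "cos \<bar>\<theta>\<bar> \<le> cos 2"
    using False assms by (intro cos_monotone_0_pi_le) auto
  then have "cos \<theta> \<le> 0" using cos_two_less_zero by (simp only: cos_abs_real)
  moreover have "\<theta>\<^sup>2 \<le> 4\<^sup>2"
    using assms pi_less_4 by (intro abs_le_square_iff[THEN iffD1]) auto
  ultimately show ?thesis by simp
qed

lemma norm_one_minus_polar:
  "(norm (1 - of_real r * cis \<theta>))\<^sup>2 = (1 - r)\<^sup>2 + 2 * r * (1 - cos \<theta>)"
proof -
  have "(norm (1 - of_real r * cis \<theta>))\<^sup>2 = (1 - r * cos \<theta>)\<^sup>2 + r\<^sup>2 * (sin \<theta>)\<^sup>2"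
    by (simp add: cmod_power2 power_mult_distrib)
  also have "\<dots> = (1 - r)\<^sup>2 + 2 * r * (1 - cos \<theta>)"
    unfolding sin_squared_eq by (simp add: power2_eq_square algebra_simps)
  finally show ?thesis .
qed

text \<open>Every summand of log |Q| is at most its value on the positive axis; a quantitative gain
  is extracted from the first summand alone, and it already suffices.\<close>

lemma norm_Q_le:
  assumes d: "0 < d" "d \<le> 1" and \<theta>: "\<bar>\<theta>\<bar> \<le> pi"
  shows "norm (Q (of_real (exp (- d)) * cis \<theta>))
           \<le> norm (Q (of_real (exp (- d)))) * exp (- (\<theta>\<^sup>2 / (72 * d\<^sup>2 * (d\<^sup>2 + \<theta>\<^sup>2))))"
proof -
  define r where "r = exp (- d)"
  define x where "x = of_real r * cis \<theta>"
  have r: "0 < r" "r < 1" using d by (auto simp: r_def)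
  have nx: "norm x = r" using r by (simp add: x_def norm_mult)
  define E where "E = \<theta>\<^sup>2 / (72 * d\<^sup>2 * (d\<^sup>2 + \<theta>\<^sup>2))"
  have first: "Re (log_term 0 x) \<le> Re (log_term 0 (of_real r)) - E"
  proof -
    \<comment> \<open>A and A + B are the squared distances from 1 to the points at angle 0 and at
      the given angle. The gain is r/A - r/(A+B), which factors as (r/A) times B/(A+B).\<close>
    define A where "A = (1 - r)\<^sup>2"
    define B where "B = 2 * r * (1 - cos \<theta>)"
    have r3: "1 / 3 \<le> r"
    proof -
      have "exp d \<le> exp 1" using d by simp
      also have "\<dots> \<le> 3" by (rule exp_le)
      finally show ?thesis by (simp add: r_def exp_minus field_simps)
    qed
    have A: "0 < A" using r by (simp add: A_def)
    have Ad: "A \<le> d\<^sup>2"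
      unfolding A_def using r exp_ge_add_one_self[of "- d"] by (intro power_mono) (auto simp: r_def)
    have B0: "0 \<le> B" using r by (simp add: B_def)
    \<comment> \<open>The factor 24 combines 1/16 from the cosine bound with 2r at least 2/3. With
      the factor 3 from r/A it produces the constant 72.\<close>
    have B: "\<theta>\<^sup>2 \<le> 24 * B"
    proof -
      have "\<theta>\<^sup>2 / 16 \<le> 1 - cos \<theta>" by (rule one_minus_cos_ge[OF \<theta>])
      moreover have "2 / 3 * (1 - cos \<theta>) \<le> B"
        unfolding B_def using r3 by (intro mult_right_mono) auto
      ultimately show ?thesis by (simp add: field_simps)
    qed
    have "1 / (3 * d\<^sup>2) = (1 / 3) / d\<^sup>2" by simp
    also have "\<dots> \<le> r / A"
      using r3 A Ad r by (intro frac_le) auto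
    finally have 1: "1 / (3 * d\<^sup>2) \<le> r / A" .
    have "\<theta>\<^sup>2 * (A + B) \<le> B * (24 * (d\<^sup>2 + \<theta>\<^sup>2))"
    proof -
      have "\<theta>\<^sup>2 * A \<le> 24 * B * d\<^sup>2" using B Ad A B0 by (intro mult_mono) auto
      moreover have "\<theta>\<^sup>2 * B \<le> 24 * B * \<theta>\<^sup>2" using B0 mult_nonneg_nonneg[of B "\<theta>\<^sup>2"]
        by (simp add: mult.commute)
      ultimately show ?thesis by (simp add: algebra_simps)
    qed
    moreover have "0 < 24 * (d\<^sup>2 + \<theta>\<^sup>2)" "0 < A + B"
      using A B0 d by (auto simp: add_pos_nonneg)
    ultimately have 2: "\<theta>\<^sup>2 / (24 * (d\<^sup>2 + \<theta>\<^sup>2)) \<le> B / (A + B)"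
      by (simp only: pos_divide_le_eq times_divide_eq_left pos_le_divide_eq)
    have "E = 1 / (3 * d\<^sup>2) * (\<theta>\<^sup>2 / (24 * (d\<^sup>2 + \<theta>\<^sup>2)))"
      by (simp add: E_def)
    also have "\<dots> \<le> r / A * (B / (A + B))"
      using 1 2 r A by (intro mult_mono) auto
    also have "\<dots> = r / A - r / (A + B)"
      using A B0 by (simp add: field_simps)
    finally have "E \<le> r / A - r / (A + B)" .
    moreover have "Re (log_term 0 x) \<le> r / (A + B)"
    proof -
      have "Re (log_term 0 x) \<le> norm (log_term 0 x)" by (rule complex_Re_le_cmod)
      also have "\<dots> = r / (norm (1 - x))\<^sup>2"
        by (simp add: log_term_def norm_divide norm_power nx)
      finally show ?thesis
        unfolding x_def norm_one_minus_polar A_def B_def .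
    qed
    moreover have "log_term 0 (of_real r) = of_real (r / A)"
      by (simp add: log_term_def A_def)
    then have "Re (log_term 0 (of_real r)) = r / A"
      by (simp only: Re_complex_of_real)
    ultimately show ?thesis by linarith
  qed
  have sm: "summable (\<lambda>k. log_term k y)" if "norm y = r" for y
    using summable_norm_log_term[of y] that r summable_norm_cancel by auto
  have sRe: "summable (\<lambda>k. Re (log_term k y))" "Re (\<Sum>k. log_term k y) = (\<Sum>k. Re (log_term k y))"
    if "norm y = r" for y
    using sm[OF that] by (auto simp: summable_Re Re_suminf)
  have nr: "norm (of_real r :: complex) = r" using r by simp
  \<comment> \<open>The \<open>if\<close> charges the gain E to index 0 only, so that the series can
    be compared term by term.\<close>
  have "(\<Sum>k. Re (log_term k x)) \<le> (\<Sum>k. Re (log_term k (of_real r)) - (if k = 0 then E else 0))"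
  proof (rule suminf_le)
    fix k
    have "Re (log_term k x) \<le> Re (log_term k (of_real r))"
      using order_trans[OF complex_Re_le_cmod norm_log_term_le_of_norm[of x k]] nx r by simp
    then show "Re (log_term k x) \<le> Re (log_term k (of_real r)) - (if k = 0 then E else 0)"
      using first by simp
  next
    show "summable (\<lambda>k. Re (log_term k (of_real r)) - (if k = 0 then E else 0))"
      by (intro summable_diff sRe nr) (rule summable_finite[of "{0}"], auto)
  qed (rule sRe nx)+
  also have "\<dots> = (\<Sum>k. Re (log_term k (of_real r))) - E"
    using suminf_diff[OF sRe(1)[OF nr] summable_finite[of "{0}" "\<lambda>k. if k = 0 then E else 0"]]
      suminf_finite[of "{0::nat}" "\<lambda>k. if k = 0 then E else 0"] by simp
  finally have "Re (\<Sum>k. log_term k x) \<le> Re (\<Sum>k. log_term k (of_real r)) - E"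
    using sRe(2) nx nr by simp
  then have "norm (Q x) \<le> norm (Q (of_real r)) * exp (- E)"
    using nx nr r by (simp add: Q_eq_exp exp_add[symmetric])
  then show ?thesis unfolding x_def r_def E_def .
qed

section \<open>Coefficients as Cauchy integrals over the whole real line\<close>

lemma ps_coeff_eq_integral:
  assumes f: "f holomorphic_on ball 0 1" and r: "0 < r" "r < 1" and s: "0 < s"
  shows "of_real (2 * pi * r ^ n) * ps_coeff n f
    = s *\<^sub>R (LINT u|lborel. indicator {-pi..pi} (s * u) *\<^sub>R
                (f (of_real r * cis (s * u)) * cis (- (real n * (s * u)))))"
proof -
  define G where "G = (\<lambda>t. f (of_real r * cis t) * cis (- (real n * t)))"
  define I where "I = of_real (2 * pi * r ^ n) * ps_coeff n f"
  have sub: "cball 0 r \<subseteq> (ball 0 1 :: complex set)" using r by auto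
  have contf: "continuous_on (ball 0 1) f" by (rule holomorphic_on_imp_continuous_on[OF f])
  have contG: "continuous_on S G" for S
    unfolding G_def
    by (intro continuous_intros continuous_on_compose2[OF contf]) (use r in \<open>auto simp: norm_mult\<close>)
  have intG: "G integrable_on {a..b}" for a b
    by (rule integrable_continuous_real[OF contG])
  \<comment> \<open>Periodicity holds because n is an integer. It moves the interval from [0, 2 pi]
    to one symmetric about the positive axis.\<close>
  have per: "G (t + 2 * pi) = G t" for t
  proof -
    have "cis (- (real n * (t + 2 * pi))) = cis (- (real n * t)) * cis (2 * pi * (- real n))"
      by (simp add: cis_mult algebra_simps)
    also have "cis (2 * pi * (- real n)) = 1"
      by (intro cis_multiple_2pi) auto
    finally show ?thesis
      by (simp add: G_def cis_mult[symmetric])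
  qed
  have "((\<lambda>u. f u / (u - 0) ^ Suc n) has_contour_integral
          (2 * pi * \<i> / fact n * (deriv ^^ n) f 0)) (circlepath 0 r)"
    using r sub by (intro Cauchy_has_contour_integral_higher_derivative_circlepath)
      (auto intro: continuous_on_subset[OF contf] holomorphic_on_subset[OF f])
  then have "((\<lambda>t. f (of_real r * cis t) / (of_real r * cis t) ^ Suc n * of_real r * \<i> * cis t)
               has_integral (2 * pi * \<i> / fact n * (deriv ^^ n) f 0)) {0..2 * pi}"
    unfolding circlepath_def by (subst (asm) has_contour_integral_part_circlepath_iff) auto
  \<comment> \<open>The factor r^n / i normalises Cauchy's formula, so that the right-hand side
    becomes 2 pi r^n times the coefficient.\<close>
  from has_integral_mult_right[OF this, of "of_real (r ^ n) / \<i>"]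
  have "((\<lambda>t. of_real (r ^ n) / \<i> * (f (of_real r * cis t) / (of_real r * cis t) ^ Suc n * of_real r * \<i> * cis t))
               has_integral I) {0..2 * pi}"
    by (simp add: I_def ps_coeff_def fps_expansion_def field_simps)
  moreover have "of_real (r ^ n) / \<i> * (f (of_real r * cis t) / (of_real r * cis t) ^ Suc n * of_real r * \<i> * cis t)
      = G t" for t
  proof -
    have "cis (- (real n * t)) = inverse (cis t ^ n)"
      by (simp add: Complex.DeMoivre)
    then show ?thesis
      using r by (simp add: G_def power_mult_distrib field_simps)
  qed
  ultimately have "(G has_integral I) {0..2 * pi}" by simp
  moreover have "(G has_integral (integral {0..pi} G + integral {pi..2 * pi} G)) {0..2 * pi}"
    by (rule has_integral_combine[where c = pi]) (auto intro: integrable_integral intG)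
  ultimately have I: "I = integral {0..pi} G + integral {pi..2 * pi} G"
    by (rule has_integral_unique)
  have "integral {pi..2 * pi} G = integral {- pi..0} G"
    using integral_shift_Icc_real[of "- pi" 0 G "2 * pi"] per by (simp add: add.commute o_def)
  then have "I = integral {- pi..0} G + integral {0..pi} G"
    by (simp add: I)
  also have "\<dots> = integral {-pi..pi} G"
    by (rule Henstock_Kurzweil_Integration.integral_combine) (auto intro: intG)
  also have "\<dots> = (LINT t|lborel. indicator {-pi..pi} t *\<^sub>R G t)"
    using set_borel_integral_eq_integral(2)[OF borel_integrable_atLeastAtMost'[OF contG]]
    by (simp add: set_lebesgue_integral_def)
  \<comment> \<open>The angle is rescaled by s while the interval stays encoded as an indicator. The
    domain thus remains the full line when s varies, as dominated convergence needs.\<close>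
  also have "\<dots> = s *\<^sub>R (LINT u|lborel. indicator {-pi..pi} (s * u) *\<^sub>R G (s * u))"
    using s by (subst lborel_integral_real_affine[where c = s and t = 0]) auto
  finally show ?thesis
    unfolding I_def G_def .
qed

lemma integrable_exp_minus_abs:
  fixes c :: real
  assumes "0 < c"
  shows "integrable lborel (\<lambda>u. exp (- (c * \<bar>u\<bar>)))"
proof -
  have 1: "integrable lborel (\<lambda>u. indicator {0<..} u *\<^sub>R exp (- (u * c)))"
    using integrable_I0i_exp_mscale[OF assms] by (simp add: set_integrable_def)
  have 2: "integrable lborel (\<lambda>u. indicator {0<..} (0 + -1 * u) *\<^sub>R exp (- ((0 + -1 * u) * c)))"
    by (rule lborel_integrable_real_affine[OF 1]) simp
  show ?thesis
  proof (rule Bochner_Integration.integrable_bound[OF Bochner_Integration.integrable_add[OF 1 2]])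
    have "AE u::real in lborel. u \<noteq> 0" by (rule AE_lborel_singleton)
    then show "AE u in lborel. norm (exp (- (c * \<bar>u\<bar>)))
        \<le> norm (indicator {0<..} u *\<^sub>R exp (- (u * c))
            + indicator {0<..} (0 + -1 * u) *\<^sub>R exp (- ((0 + -1 * u) * c)))"
      by eventually_elim (auto simp: abs_if mult.commute split: split_indicator)
  qed auto
qed

subsection \<open>Expansion near the positive axis\<close>

text \<open>The operator y d/dy multiplies the j-th coefficient by j; iterating it yields the closed
  forms of the power moments below.\<close>

lemma power_series_times_index_sums:
  fixes f :: "'a :: {real_normed_field, banach} \<Rightarrow> 'a"
  assumes sums: "\<And>z. norm z < 1 \<Longrightarrow> (\<lambda>j. c j * z ^ j) sums f z"
    and deriv: "(f has_field_derivative f') (at y)" and y: "norm y < 1"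
  shows "(\<lambda>j. of_nat j * c j * y ^ j) sums (y * f')"
proof -
  have "(\<lambda>n. diffs c n * y ^ n) sums f'"
    by (rule termdiffs_sums_strong[OF sums deriv y])
  from sums_mult[OF this, of y]
  have "(\<lambda>n. of_nat (Suc n) * c (Suc n) * y ^ Suc n) sums (y * f')"
    by (simp add: diffs_def mult_ac)
  then show ?thesis by (subst (asm) sums_Suc_iff) simp
qed

text \<open>\<open>moment2\<close>, \<open>moment3\<close> and \<open>moment4\<close> are the sums
  of j^m y^j for m = 2, 3, 4, with Eulerian polynomials in the numerators. At y = e^{-x} they equal,
  up to sign, the m-th derivatives of 1/(1 - e^{-x}), whence the leading terms m!/x^{m+1}.\<close>

definition moment2 :: "real \<Rightarrow> real" where
  "moment2 y = y * (1 + y) / (1 - y) ^ 3"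

definition moment3 :: "real \<Rightarrow> real" where
  "moment3 y = y * (1 + 4 * y + y\<^sup>2) / (1 - y) ^ 4"

definition moment4 :: "real \<Rightarrow> real" where
  "moment4 y = y * (1 + 11 * y + 11 * y\<^sup>2 + y ^ 3) / (1 - y) ^ 5"

lemma moment1_sums:
  fixes y :: "'a :: {real_normed_field, banach}"
  assumes "norm y < 1"
  shows "(\<lambda>j. of_nat j * y ^ j) sums (y / (1 - y)\<^sup>2)"
  using sums_of_nat_mult_power[OF assms] by (subst (asm) sums_Suc_iff) simp

lemma moment2_sums:
  assumes "norm y < 1"
  shows "(\<lambda>j. real j ^ 2 * y ^ j) sums moment2 y"
proof -
  have "((\<lambda>y. y / (1 - y)\<^sup>2) has_field_derivative ((1 + y) / (1 - y) ^ 3)) (at y)"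
    using assms by (auto intro!: derivative_eq_intros simp: divide_simps) algebra
  from power_series_times_index_sums[OF moment1_sums this assms]
  show ?thesis by (simp add: moment2_def power2_eq_square)
qed

lemma moment3_sums:
  assumes "norm y < 1"
  shows "(\<lambda>j. real j ^ 3 * y ^ j) sums moment3 y"
proof -
  have "(moment2 has_field_derivative ((1 + 4 * y + y\<^sup>2) / (1 - y) ^ 4)) (at y)"
    unfolding moment2_def[abs_def]
    using assms by (auto intro!: derivative_eq_intros simp: divide_simps) algebra
  from power_series_times_index_sums[OF moment2_sums this assms]
  show ?thesis by (simp add: moment3_def power2_eq_square power3_eq_cube mult.assoc)
qed

lemma moment4_sums:
  assumes "norm y < 1"
  shows "(\<lambda>j. real j ^ 4 * y ^ j) sums moment4 y"
proof -
  have "(moment3 has_field_derivative ((1 + 11 * y + 11 * y\<^sup>2 + y ^ 3) / (1 - y) ^ 5)) (at y)"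
    unfolding moment3_def[abs_def]
    using assms by (auto intro!: derivative_eq_intros simp: divide_simps) algebra
  from power_series_times_index_sums[OF moment3_sums this assms]
  show ?thesis by (simp add: moment4_def numeral_eq_Suc mult.assoc)
qed

text \<open>Finite limits control both ends and compactness controls the middle. This upgrades
  limits at 0 and infinity to bounds valid for all x > 0, which are needed because x = (k+1) d
  ranges over both regimes.\<close>

lemma bounded_on_pos_real:
  fixes f :: "real \<Rightarrow> real"
  assumes cont: "continuous_on {0<..} f"
    and lim0: "(f \<longlongrightarrow> a) (at_right 0)" and lim1: "(f \<longlongrightarrow> b) at_top"
  obtains C where "C > 0" "\<And>x. 0 < x \<Longrightarrow> \<bar>f x\<bar> \<le> C"
proof -
  have "eventually (\<lambda>x. \<bar>f x\<bar> < \<bar>a\<bar> + 1) (at_right 0)"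
    by (rule order_tendstoD(2)[OF tendsto_rabs[OF lim0]]) simp
  then obtain e where e: "e > 0" "\<And>x. 0 < x \<Longrightarrow> x < e \<Longrightarrow> \<bar>f x\<bar> < \<bar>a\<bar> + 1"
    by (auto simp: eventually_at_right_field)
  have "eventually (\<lambda>x. \<bar>f x\<bar> < \<bar>b\<bar> + 1) at_top"
    by (rule order_tendstoD(2)[OF tendsto_rabs[OF lim1]]) simp
  then obtain N where N: "\<And>x. x \<ge> N \<Longrightarrow> \<bar>f x\<bar> < \<bar>b\<bar> + 1"
    by (auto simp: eventually_at_top_linorder)
  have "compact (f ` {e..N})"
    using e by (intro compact_continuous_image continuous_on_subset[OF cont]) auto
  then obtain B where B: "\<And>x. x \<in> {e..N} \<Longrightarrow> \<bar>f x\<bar> \<le> B"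
    using compact_imp_bounded bounded_iff by (metis imageI real_norm_def)
  show ?thesis
  proof (rule that[of "\<bar>a\<bar> + \<bar>b\<bar> + \<bar>B\<bar> + 1"])
    fix x :: real assume "0 < x"
    then show "\<bar>f x\<bar> \<le> \<bar>a\<bar> + \<bar>b\<bar> + \<bar>B\<bar> + 1"
      using e(2)[of x] N[of x] B[of x] by (cases "x < e"; cases "x \<ge> N") auto
  qed auto
qed

text \<open>The exponent 3/2 lies strictly between 1 and 2. More than 1 makes the errors at x =
  (k+1) d summable over k; less than 2 makes the error vanish after multiplication by an angle of
  order d^2.\<close>

lemma moment2_asymp:
  obtains C where "C > 0" "\<And>x. 0 < x \<Longrightarrow> \<bar>moment2 (exp (- x)) - 2 / x ^ 3\<bar> \<le> C * x powr (-3/2)"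
proof -
  define f where "f = (\<lambda>x::real. x powr (3/2) * (moment2 (exp (- x)) - 2 / x ^ 3))"
  have "continuous_on {0<..} f"
    unfolding f_def moment2_def by (intro continuous_intros) auto
  moreover have "(f \<longlongrightarrow> 0) (at_right 0)"
    unfolding f_def moment2_def by real_asymp
  moreover have "(f \<longlongrightarrow> 0) at_top"
    unfolding f_def moment2_def by real_asymp
  ultimately obtain C where C: "C > 0" "\<And>x. 0 < x \<Longrightarrow> \<bar>f x\<bar> \<le> C"
    using bounded_on_pos_real by blast
  show ?thesis
  proof (rule that[OF C(1)])
    fix x :: real assume x: "0 < x"
    then have "moment2 (exp (- x)) - 2 / x ^ 3 = f x * x powr (-3/2)"
      by (simp add: f_def mult_ac powr_add[symmetric])
    then show "\<bar>moment2 (exp (- x)) - 2 / x ^ 3\<bar> \<le> C * x powr (-3/2)"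
      using C(2)[OF x] by (simp add: abs_mult mult_right_mono)
  qed
qed

lemma moment3_asymp:
  obtains C where "C > 0" "\<And>x. 0 < x \<Longrightarrow> \<bar>moment3 (exp (- x)) - 6 / x ^ 4\<bar> \<le> C / x ^ 3"
proof -
  define f where "f = (\<lambda>x::real. x ^ 3 * (moment3 (exp (- x)) - 6 / x ^ 4))"
  have "continuous_on {0<..} f"
    unfolding f_def moment3_def by (intro continuous_intros) auto
  moreover have "(f \<longlongrightarrow> 0) (at_right 0)"
    unfolding f_def moment3_def by real_asymp
  moreover have "(f \<longlongrightarrow> 0) at_top"
    unfolding f_def moment3_def by real_asymp
  ultimately obtain C where C: "C > 0" "\<And>x. 0 < x \<Longrightarrow> \<bar>f x\<bar> \<le> C"
    using bounded_on_pos_real by blast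
  show ?thesis
  proof (rule that[OF C(1)])
    fix x :: real assume x: "0 < x"
    then have "moment3 (exp (- x)) - 6 / x ^ 4 = f x / x ^ 3"
      by (simp add: f_def)
    then show "\<bar>moment3 (exp (- x)) - 6 / x ^ 4\<bar> \<le> C / x ^ 3"
      using C(2)[OF x] x by (simp add: abs_mult divide_right_mono)
  qed
qed

lemma moment4_asymp:
  obtains C where "C > 0" "\<And>x. 0 < x \<Longrightarrow> moment4 (exp (- x)) \<le> C / x ^ 5"
proof -
  define f where "f = (\<lambda>x::real. x ^ 5 * moment4 (exp (- x)))"
  have "continuous_on {0<..} f"
    unfolding f_def moment4_def by (intro continuous_intros) auto
  moreover have "(f \<longlongrightarrow> 24) (at_right 0)"
    unfolding f_def moment4_def by real_asymp
  moreover have "(f \<longlongrightarrow> 0) at_top"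
    unfolding f_def moment4_def by real_asymp
  ultimately obtain C where C: "C > 0" "\<And>x. 0 < x \<Longrightarrow> \<bar>f x\<bar> \<le> C"
    using bounded_on_pos_real by blast
  show ?thesis
  proof (rule that[OF C(1)])
    fix x :: real assume x: "0 < x"
    then show "moment4 (exp (- x)) \<le> C / x ^ 5"
      using C(2)[OF x] by (simp add: f_def field_simps)
  qed
qed

text \<open>With K = k + 1 and y = e^{-Kd}, \<open>log_term k\<close> is the sum over j of (j/K) y^j
  e^{ijK theta}. Each exponential is expanded to second order in the angle with cubic remainder, and
  the powers of j collect into the moments.\<close>

lemma log_term_taylor:
  fixes d \<theta> :: real and k :: nat
  assumes d: "0 < d"
  defines "K \<equiv> real (Suc k)"
  shows "norm (log_term k (of_real (exp (- d)) * cis \<theta>) - log_term k (of_real (exp (- d)))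
            - \<i> * of_real (\<theta> * moment2 (exp (- (K * d))))
            + of_real (\<theta>\<^sup>2 / 2 * (K * moment3 (exp (- (K * d))))))
        \<le> \<bar>\<theta>\<bar> ^ 3 / 6 * (K\<^sup>2 * moment4 (exp (- (K * d))))"
proof -
  define y where "y = exp (- (K * d))"
  have K: "K > 0" by (simp add: K_def)
  have y: "0 < y" "y < 1" using K d by (auto simp: y_def)
  have pow: "(of_real (exp (- d)) * cis t) ^ Suc k = of_real y * cis (K * t)" for t
    unfolding power_mult_distrib Complex.DeMoivre K_def[symmetric]
    by (simp only: y_def of_real_power[symmetric] exp_of_nat_mult[symmetric] K_def mult_minus_right)
  have lt: "(\<lambda>j. of_real (1 / K * (real j * y ^ j)) * cis (real j * (K * t)))
      sums log_term k (of_real (exp (- d)) * cis t)" for t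
  proof -
    have "norm (of_real y * cis (K * t)) < 1" using y by (simp add: norm_mult)
    from sums_mult[OF moment1_sums[OF this], of "of_real (1 / K)"]
    have "(\<lambda>j. of_real (1 / K) * (of_nat j * (of_real y * cis (K * t)) ^ j))
        sums log_term k (of_real (exp (- d)) * cis t)"
      unfolding log_term_def pow by (simp add: K_def)
    then show ?thesis
      by (simp add: power_mult_distrib Complex.DeMoivre mult_ac)
  qed
  have ny: "norm y < 1" using y by simp
  have s2: "(\<lambda>j. \<i> * of_real (\<theta> * (real j ^ 2 * y ^ j))) sums (\<i> * of_real (\<theta> * moment2 y))"
    by (intro sums_mult sums_of_real moment2_sums ny)
  have s3: "(\<lambda>j. of_real (\<theta>\<^sup>2 / 2 * (K * (real j ^ 3 * y ^ j)))) sums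
      (of_real (\<theta>\<^sup>2 / 2 * (K * moment3 y)) :: complex)"
    by (intro sums_mult sums_of_real moment3_sums ny)
  have s4: "(\<lambda>j. \<bar>\<theta>\<bar> ^ 3 / 6 * (K\<^sup>2 * (real j ^ 4 * y ^ j))) sums (\<bar>\<theta>\<bar> ^ 3 / 6 * (K\<^sup>2 * moment4 y))"
    by (intro sums_mult moment4_sums ny)
  have s1: "(\<lambda>j. of_real (1 / K * (real j * y ^ j)) :: complex) sums log_term k (of_real (exp (- d)))"
    using lt[of 0] by simp
  have "norm (log_term k (of_real (exp (- d)) * cis \<theta>) - log_term k (of_real (exp (- d)))
            - \<i> * of_real (\<theta> * moment2 y) + of_real (\<theta>\<^sup>2 / 2 * (K * moment3 y)))
        \<le> \<bar>\<theta>\<bar> ^ 3 / 6 * (K\<^sup>2 * moment4 y)"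
  proof (rule norm_sums_le[OF sums_add[OF sums_diff[OF sums_diff[OF lt s1] s2] s3] s4])
    fix j
    define x where "x = real j * (K * \<theta>)"
    have "norm (cis x - 1 - \<i> * of_real x + of_real (x\<^sup>2 / 2)) \<le> \<bar>x\<bar> ^ 3 / 6"
      using iexp_approx1[of x 2] by (simp add: numeral_eq_Suc cis_conv_exp algebra_simps)
    then have "1 / K * (real j * y ^ j) * norm (cis x - 1 - \<i> * of_real x + of_real (x\<^sup>2 / 2))
        \<le> 1 / K * (real j * y ^ j) * (\<bar>x\<bar> ^ 3 / 6)"
      using K y by (intro mult_left_mono) auto
    also have "\<dots> = \<bar>\<theta>\<bar> ^ 3 / 6 * (K\<^sup>2 * (real j ^ 4 * y ^ j))"
      using K by (simp add: x_def abs_mult power_mult_distrib field_simps numeral_eq_Suc)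
    also have "1 / K * (real j * y ^ j) * norm (cis x - 1 - \<i> * of_real x + of_real (x\<^sup>2 / 2))
       = norm (of_real (1 / K * (real j * y ^ j)) * (cis x - 1 - \<i> * of_real x + of_real (x\<^sup>2 / 2)))"
      unfolding norm_mult norm_of_real using K y by simp
    also have "of_real (1 / K * (real j * y ^ j)) * (cis x - 1 - \<i> * of_real x + of_real (x\<^sup>2 / 2))
      = of_real (1 / K * (real j * y ^ j)) * cis (real j * (K * \<theta>)) - of_real (1 / K * (real j * y ^ j))
         - \<i> * of_real (\<theta> * (real j ^ 2 * y ^ j)) + of_real (\<theta>\<^sup>2 / 2 * (K * (real j ^ 3 * y ^ j)))"
      using K by (simp add: x_def power2_eq_square power3_eq_cube ring_distribs diff_divide_distrib mult_ac)
    finally show "norm (of_real (1 / K * (real j * y ^ j)) * cis (real j * (K * \<theta>)) - of_real (1 / K * (real j * y ^ j))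
         - \<i> * of_real (\<theta> * (real j ^ 2 * y ^ j)) + of_real (\<theta>\<^sup>2 / 2 * (K * (real j ^ 3 * y ^ j))))
        \<le> \<bar>\<theta>\<bar> ^ 3 / 6 * (K\<^sup>2 * (real j ^ 4 * y ^ j))" .
  qed
  then show ?thesis unfolding y_def .
qed

lemma zeta_3_sums: "(\<lambda>k. 1 / real (Suc k) ^ 3) sums zeta 3"
proof -
  have "summable (\<lambda>k. 1 / real (Suc k) ^ 3)"
    using inverse_power_summable[of 3, where 'a = real] summable_Suc_iff[of "\<lambda>n. inverse (real n ^ 3)"]
    by (simp add: inverse_eq_divide del: of_nat_Suc)
  then show ?thesis
    unfolding zeta_def by (simp add: sums_iff powr_realpow flip: powr_numeral)
qed

lemma zeta_3_pos: "zeta 3 > 0"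
  using zeta_3_sums suminf_pos[of "\<lambda>k. 1 / real (Suc k) ^ 3"] by (auto simp: sums_iff)

text \<open>The leading terms of the moments contribute 2/(Kd)^3 to the linear and 3/(K^3 d^4) to
  the quadratic coefficient; in both, summing over K produces zeta(3). The rest is an error summable
  over K.\<close>

lemma log_Q_taylor:
  obtains C where "\<And>d \<theta>. 0 < d \<Longrightarrow>
    norm ((\<Sum>k. log_term k (of_real (exp (- d)) * cis \<theta>)) - (\<Sum>k. log_term k (of_real (exp (- d))))
        - \<i> * of_real (2 * zeta 3 * \<theta> / d ^ 3) + of_real (3 * zeta 3 * \<theta>\<^sup>2 / d ^ 4))
      \<le> C * (\<bar>\<theta>\<bar> * d powr (-3/2) + \<theta>\<^sup>2 / d ^ 3 + \<bar>\<theta>\<bar> ^ 3 / d ^ 5)"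
proof -
  obtain C2 where C2: "C2 > 0" "\<And>x. 0 < x \<Longrightarrow> \<bar>moment2 (exp (- x)) - 2 / x ^ 3\<bar> \<le> C2 * x powr (-3/2)"
    using moment2_asymp by blast
  obtain C3 where C3: "C3 > 0" "\<And>x. 0 < x \<Longrightarrow> \<bar>moment3 (exp (- x)) - 6 / x ^ 4\<bar> \<le> C3 / x ^ 3"
    using moment3_asymp by blast
  obtain C4 where C4: "C4 > 0" "\<And>x. 0 < x \<Longrightarrow> moment4 (exp (- x)) \<le> C4 / x ^ 5"
    using moment4_asymp by blast
  define C where "C = C2 + C3 + C4"
  have C: "C2 \<le> C" "C3 \<le> C" "C4 \<le> C" "0 \<le> C" using C2(1) C3(1) C4(1) by (auto simp: C_def)
  \<comment> \<open>One weight for all three errors, whose dependence on K is K^{-3/2}, K^{-2} and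
    K^{-3}.\<close>
  define w where "w = (\<lambda>k. real (Suc k) powr (-3/2))"
  have w: "summable w"
    unfolding w_def using summable_real_powr_iff[of "-3/2"]
      summable_Suc_iff[of "\<lambda>n. real n powr (-3/2)"] by (simp del: of_nat_Suc)
  show ?thesis
  proof (rule that[of "C * suminf w"])
    fix d \<theta> :: real assume d: "0 < d"
    define E where "E = \<bar>\<theta>\<bar> * d powr (-3/2) + \<theta>\<^sup>2 / d ^ 3 + \<bar>\<theta>\<bar> ^ 3 / d ^ 5"
    have sm: "(\<lambda>k. log_term k y) sums (\<Sum>k. log_term k y)" if "norm y = exp (- d)" for y
      by (rule summable_sums[OF summable_norm_cancel[OF summable_norm_log_term]]) (use that d in simp)
    have s: "(\<lambda>k. log_term k (of_real (exp (- d)) * cis \<theta>) - log_term k (of_real (exp (- d)))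
              - \<i> * of_real (2 * \<theta> / d ^ 3 * (1 / real (Suc k) ^ 3))
              + of_real (3 * \<theta>\<^sup>2 / d ^ 4 * (1 / real (Suc k) ^ 3)))
       sums ((\<Sum>k. log_term k (of_real (exp (- d)) * cis \<theta>)) - (\<Sum>k. log_term k (of_real (exp (- d))))
              - \<i> * of_real (2 * \<theta> / d ^ 3 * zeta 3) + of_real (3 * \<theta>\<^sup>2 / d ^ 4 * zeta 3))"
      by (intro sums_add sums_diff sm sums_mult sums_of_real zeta_3_sums) (auto simp: norm_mult)
    have "norm ((\<Sum>k. log_term k (of_real (exp (- d)) * cis \<theta>)) - (\<Sum>k. log_term k (of_real (exp (- d))))
        - \<i> * of_real (2 * \<theta> / d ^ 3 * zeta 3) + of_real (3 * \<theta>\<^sup>2 / d ^ 4 * zeta 3))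
      \<le> C * suminf w * E"
    proof (rule norm_sums_le[OF s])
      show "(\<lambda>k. C * w k * E) sums (C * suminf w * E)"
        by (intro sums_mult sums_mult2 summable_sums w)
      fix k
      define K where "K = real (Suc k)"
      have K: "1 \<le> K" by (simp add: K_def)
      define T where "T = log_term k (of_real (exp (- d)) * cis \<theta>) - log_term k (of_real (exp (- d)))
            - \<i> * of_real (\<theta> * moment2 (exp (- (K * d))))
            + of_real (\<theta>\<^sup>2 / 2 * (K * moment3 (exp (- (K * d)))))"
      \<comment> \<open>The deviations a and b of the two moments from their leading terms, kept
        apart from the Taylor remainder T.\<close>
      define a where "a = moment2 (exp (- (K * d))) - 2 / (K * d) ^ 3"
      define b where "b = moment3 (exp (- (K * d))) - 6 / (K * d) ^ 4"
      have Kd: "0 < K * d" using K d by simp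
      have wk: "1 / K ^ m \<le> w k" if "m \<ge> 2" for m
      proof -
        have "1 / K ^ m = K powr (- real m)"
          using K by (simp add: powr_minus powr_realpow field_simps)
        also have "\<dots> \<le> K powr (-3/2)"
          using K that by (intro powr_mono) auto
        finally show ?thesis by (simp add: w_def K_def)
      qed
      have nT: "norm T \<le> C * (w k * (\<bar>\<theta>\<bar> ^ 3 / d ^ 5))"
      proof -
        have "norm T \<le> \<bar>\<theta>\<bar> ^ 3 / 6 * (K\<^sup>2 * moment4 (exp (- (K * d))))"
          unfolding T_def K_def by (rule log_term_taylor[OF d])
        also have "\<dots> \<le> \<bar>\<theta>\<bar> ^ 3 / 6 * (K\<^sup>2 * (C4 / (K * d) ^ 5))"
          using C4(2)[OF Kd] by (intro mult_left_mono) auto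
        also have "\<dots> = C4 / 6 * (1 / K ^ 3 * (\<bar>\<theta>\<bar> ^ 3 / d ^ 5))"
          using K d by (simp add: field_simps power_mult_distrib power2_eq_square numeral_eq_Suc)
        also have "\<dots> \<le> C * (w k * (\<bar>\<theta>\<bar> ^ 3 / d ^ 5))"
          using wk[of 3] C C4 d K by (intro mult_mono mult_right_mono) auto
        finally show ?thesis .
      qed
      have na: "\<bar>\<theta>\<bar> * \<bar>a\<bar> \<le> C * (w k * (\<bar>\<theta>\<bar> * d powr (-3/2)))"
      proof -
        have "\<bar>a\<bar> \<le> C2 * (K * d) powr (-3/2)"
          unfolding a_def by (rule C2(2)[OF Kd])
        also have "\<dots> \<le> C * (w k * d powr (-3/2))"
          using C K d by (simp add: powr_mult w_def K_def mult_right_mono)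
        finally have "\<bar>\<theta>\<bar> * \<bar>a\<bar> \<le> \<bar>\<theta>\<bar> * (C * (w k * d powr (-3/2)))"
          by (rule mult_left_mono) simp
        then show ?thesis by (simp add: mult_ac)
      qed
      have nb: "\<theta>\<^sup>2 / 2 * (K * \<bar>b\<bar>) \<le> C * (w k * (\<theta>\<^sup>2 / d ^ 3))"
      proof -
        have "\<theta>\<^sup>2 / 2 * (K * \<bar>b\<bar>) \<le> \<theta>\<^sup>2 / 2 * (K * (C3 / (K * d) ^ 3))"
          unfolding b_def using C3(2)[OF Kd] K by (intro mult_left_mono) auto
        also have "\<dots> = C3 / 2 * (1 / K ^ 2 * (\<theta>\<^sup>2 / d ^ 3))"
          using K d by (simp add: field_simps power_mult_distrib power2_eq_square numeral_eq_Suc)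
        also have "\<dots> \<le> C * (w k * (\<theta>\<^sup>2 / d ^ 3))"
          using wk[of 2] C C3 d K by (intro mult_mono mult_right_mono) auto
        finally show ?thesis .
      qed
      have "log_term k (of_real (exp (- d)) * cis \<theta>) - log_term k (of_real (exp (- d)))
              - \<i> * of_real (2 * \<theta> / d ^ 3 * (1 / K ^ 3)) + of_real (3 * \<theta>\<^sup>2 / d ^ 4 * (1 / K ^ 3))
          = T + \<i> * of_real (\<theta> * a) - of_real (\<theta>\<^sup>2 / 2 * (K * b))"
      proof -
        have 1: "2 * \<theta> / d ^ 3 * (1 / K ^ 3) = \<theta> * moment2 (exp (- (K * d))) - \<theta> * a"
          by (simp add: a_def power_mult_distrib algebra_simps)
        have 2: "3 * \<theta>\<^sup>2 / d ^ 4 * (1 / K ^ 3)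
            = \<theta>\<^sup>2 / 2 * (K * moment3 (exp (- (K * d)))) - \<theta>\<^sup>2 / 2 * (K * b)"
          using K d by (simp add: b_def power_mult_distrib field_simps) (simp add: numeral_eq_Suc)
        show ?thesis unfolding T_def 1 2 by (simp add: algebra_simps)
      qed
      also have "norm \<dots> \<le> norm T + norm (\<i> * of_real (\<theta> * a)) + norm (of_real (\<theta>\<^sup>2 / 2 * (K * b)) :: complex)"
        by (intro order_trans[OF norm_triangle_ineq4] add_right_mono norm_triangle_ineq)
      also have "\<dots> = norm T + \<bar>\<theta>\<bar> * \<bar>a\<bar> + \<theta>\<^sup>2 / 2 * (K * \<bar>b\<bar>)"
        unfolding norm_mult norm_of_real norm_ii abs_mult using K by simp
      also have "\<dots> \<le> C * (w k * (\<bar>\<theta>\<bar> ^ 3 / d ^ 5)) + C * (w k * (\<bar>\<theta>\<bar> * d powr (-3/2)))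
           + C * (w k * (\<theta>\<^sup>2 / d ^ 3))"
        by (intro add_mono nT na nb)
      also have "\<dots> = C * w k * E"
        by (simp add: E_def algebra_simps)
      finally show "norm (log_term k (of_real (exp (- d)) * cis \<theta>) - log_term k (of_real (exp (- d)))
              - \<i> * of_real (2 * \<theta> / d ^ 3 * (1 / real (Suc k) ^ 3))
              + of_real (3 * \<theta>\<^sup>2 / d ^ 4 * (1 / real (Suc k) ^ 3))) \<le> C * w k * E"
        unfolding K_def .
    qed
    moreover have "2 * \<theta> / d ^ 3 * zeta 3 = 2 * zeta 3 * \<theta> / d ^ 3"
      "3 * \<theta>\<^sup>2 / d ^ 4 * zeta 3 = 3 * zeta 3 * \<theta>\<^sup>2 / d ^ 4" by auto
    ultimately show "norm ((\<Sum>k. log_term k (of_real (exp (- d)) * cis \<theta>)) - (\<Sum>k. log_term k (of_real (exp (- d))))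
        - \<i> * of_real (2 * zeta 3 * \<theta> / d ^ 3) + of_real (3 * zeta 3 * \<theta>\<^sup>2 / d ^ 4))
      \<le> C * suminf w * (\<bar>\<theta>\<bar> * d powr (-3/2) + \<theta>\<^sup>2 / d ^ 3 + \<bar>\<theta>\<bar> ^ 3 / d ^ 5)"
      unfolding E_def by (simp only:)
  qed
qed

text \<open>At angle d^2 u the quadratic term no longer depends on d, and the three errors become
  multiples of d^{1/2}, d and d. The index is a sequence m so that the result also applies to
  shifted sequences.\<close>

lemma Q_ratio_tendsto:
  fixes d :: "nat \<Rightarrow> real" and u :: real
  assumes pos: "\<And>n. 0 < d n" and d0: "d \<longlonglongrightarrow> 0"
    and saddle: "(\<lambda>n. 2 * zeta 3 / d n - real (m n) * d n ^ 2) \<longlonglongrightarrow> 0"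
  shows "(\<lambda>n. Q (of_real (exp (- d n)) * cis (d n ^ 2 * u)) / Q (of_real (exp (- d n)))
               * cis (- (real (m n) * (d n ^ 2 * u))))
         \<longlonglongrightarrow> of_real (exp (- (3 * zeta 3 * u\<^sup>2)))"
proof -
  define L where "L = (\<lambda>x. \<Sum>k. log_term k x)"
  define X where "X = (\<lambda>n. L (of_real (exp (- d n)) * cis (d n ^ 2 * u)) - L (of_real (exp (- d n))))"
  obtain C where C: "\<And>d \<theta>. 0 < d \<Longrightarrow>
    norm (L (of_real (exp (- d)) * cis \<theta>) - L (of_real (exp (- d)))
        - \<i> * of_real (2 * zeta 3 * \<theta> / d ^ 3) + of_real (3 * zeta 3 * \<theta>\<^sup>2 / d ^ 4))
      \<le> C * (\<bar>\<theta>\<bar> * d powr (-3/2) + \<theta>\<^sup>2 / d ^ 3 + \<bar>\<theta>\<bar> ^ 3 / d ^ 5)"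
    unfolding L_def using log_Q_taylor by blast
  have "(\<lambda>n. X n - \<i> * of_real (2 * zeta 3 * u / d n) + of_real (3 * zeta 3 * u\<^sup>2)) \<longlonglongrightarrow> 0"
  proof (rule Lim_null_comparison)
    have "(\<lambda>n. C * (\<bar>u\<bar> * d n powr (1/2) + u\<^sup>2 * d n + \<bar>u\<bar> ^ 3 * d n))
        \<longlonglongrightarrow> C * (\<bar>u\<bar> * 0 powr (1/2) + u\<^sup>2 * 0 + \<bar>u\<bar> ^ 3 * 0)"
      using pos by (intro tendsto_intros tendsto_powr2 d0) (auto intro!: always_eventually less_imp_le)
    then show "(\<lambda>n. C * (\<bar>u\<bar> * d n powr (1/2) + u\<^sup>2 * d n + \<bar>u\<bar> ^ 3 * d n)) \<longlonglongrightarrow> 0"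
      by simp
    have "norm (X n - \<i> * of_real (2 * zeta 3 * u / d n) + of_real (3 * zeta 3 * u\<^sup>2))
        \<le> C * (\<bar>u\<bar> * d n powr (1/2) + u\<^sup>2 * d n + \<bar>u\<bar> ^ 3 * d n)" for n
    proof -
      have p: "d n > 0" by (rule pos)
      have "d n ^ 2 * d n powr (-3/2) = d n powr 2 * d n powr (-3/2)"
        using p by (simp add: powr_numeral)
      also have "\<dots> = d n powr (1/2)" by (simp add: powr_add[symmetric])
      finally have 1: "\<bar>d n ^ 2 * u\<bar> * d n powr (-3/2) = \<bar>u\<bar> * d n powr (1/2)"
        by (simp add: abs_mult mult_ac)
      have 2: "(d n ^ 2 * u)\<^sup>2 / d n ^ 3 = u\<^sup>2 * d n" "\<bar>d n ^ 2 * u\<bar> ^ 3 / d n ^ 5 = \<bar>u\<bar> ^ 3 * d n"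
        "2 * zeta 3 * (d n ^ 2 * u) / d n ^ 3 = 2 * zeta 3 * u / d n"
        "3 * zeta 3 * (d n ^ 2 * u)\<^sup>2 / d n ^ 4 = 3 * zeta 3 * u\<^sup>2"
        using p by (simp_all add: field_simps abs_mult numeral_eq_Suc)
      show ?thesis
        using C[OF p, of "d n ^ 2 * u"] unfolding X_def 1 2 .
    qed
    then show "\<forall>\<^sub>F n in sequentially. norm (X n - \<i> * of_real (2 * zeta 3 * u / d n) + of_real (3 * zeta 3 * u\<^sup>2))
        \<le> C * (\<bar>u\<bar> * d n powr (1/2) + u\<^sup>2 * d n + \<bar>u\<bar> ^ 3 * d n)"
      by (rule always_eventually[OF allI])
  qed
  \<comment> \<open>The linear term of log Q and the phase of x^{-m} together leave u times the
    saddle-point defect, which tends to 0.\<close>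
  moreover have "(\<lambda>n. \<i> * of_real (u * (2 * zeta 3 / d n - real (m n) * d n ^ 2))) \<longlonglongrightarrow> \<i> * of_real (u * 0)"
    by (intro tendsto_intros saddle)
  ultimately have "(\<lambda>n. (X n - \<i> * of_real (2 * zeta 3 * u / d n) + of_real (3 * zeta 3 * u\<^sup>2))
       + \<i> * of_real (u * (2 * zeta 3 / d n - real (m n) * d n ^ 2)) - of_real (3 * zeta 3 * u\<^sup>2))
       \<longlonglongrightarrow> 0 + \<i> * of_real (u * 0) - of_real (3 * zeta 3 * u\<^sup>2)"
    by (intro tendsto_add tendsto_diff tendsto_const)
  moreover have "(X n - \<i> * of_real (2 * zeta 3 * u / d n) + of_real (3 * zeta 3 * u\<^sup>2))
       + \<i> * of_real (u * (2 * zeta 3 / d n - real (m n) * d n ^ 2)) - of_real (3 * zeta 3 * u\<^sup>2)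
       = X n + \<i> * of_real (- (real (m n) * (d n ^ 2 * u)))" for n
    by (simp add: algebra_simps)
  ultimately have "(\<lambda>n. exp (X n + \<i> * of_real (- (real (m n) * (d n ^ 2 * u)))))
      \<longlonglongrightarrow> exp (- of_real (3 * zeta 3 * u\<^sup>2))"
    by (intro tendsto_exp) (simp only: mult_zero_right of_real_0 add_0_left diff_0)
  moreover have "exp (X n + \<i> * of_real (- (real (m n) * (d n ^ 2 * u))))
     = Q (of_real (exp (- d n)) * cis (d n ^ 2 * u)) / Q (of_real (exp (- d n)))
               * cis (- (real (m n) * (d n ^ 2 * u)))" for n
  proof -
    have "Q y = exp (L y)" if "norm y = exp (- d n)" for y
      unfolding L_def using pos[of n] that by (intro Q_eq_exp) simp
    then have "exp (X n) = Q (of_real (exp (- d n)) * cis (d n ^ 2 * u)) / Q (of_real (exp (- d n)))"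
      by (simp add: norm_mult X_def exp_diff)
    then show ?thesis
      by (simp only: exp_add cis_conv_exp)
  qed
  moreover have "exp (- of_real (3 * zeta 3 * u\<^sup>2)) = complex_of_real (exp (- (3 * zeta 3 * u\<^sup>2)))"
    by (simp only: of_real_minus[symmetric] exp_of_real)
  ultimately show ?thesis
    by (simp only:)
qed

text \<open>An integrable majorant independent of d. Since d^2 |u| is at most pi < 4, the exponent
  in \<open>norm_Q_le\<close> is at least u^2/(72 (1 + 4|u|)), and this is at least (|u| - 1)/360
  with 360 = 5 times 72.\<close>

lemma Q_ratio_le:
  assumes d: "0 < d" "d \<le> 1" and u: "\<bar>d\<^sup>2 * u\<bar> \<le> pi"
  shows "norm (Q (of_real (exp (- d)) * cis (d\<^sup>2 * u)) / Q (of_real (exp (- d))))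
           \<le> exp (1/360) * exp (- (1/360 * \<bar>u\<bar>))"
proof -
  have "norm (Q (of_real (exp (- d)) * cis (d\<^sup>2 * u)) / Q (of_real (exp (- d))))
      \<le> exp (- ((d\<^sup>2 * u)\<^sup>2 / (72 * d\<^sup>2 * (d\<^sup>2 + (d\<^sup>2 * u)\<^sup>2))))"
    using norm_Q_le[OF d u] Q_nonzero[of "of_real (exp (- d))"] d
    by (simp add: norm_divide divide_le_eq mult.commute)
  also have "(d\<^sup>2 * u)\<^sup>2 / (72 * d\<^sup>2 * (d\<^sup>2 + (d\<^sup>2 * u)\<^sup>2)) = u\<^sup>2 / (72 * (1 + (d\<^sup>2 * \<bar>u\<bar>) * \<bar>u\<bar>))"
  proof -
    have "72 * d\<^sup>2 * (d\<^sup>2 + (d\<^sup>2 * u)\<^sup>2) = d ^ 4 * (72 * (1 + (d\<^sup>2 * \<bar>u\<bar>) * \<bar>u\<bar>))"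
      by (simp add: algebra_simps power2_eq_square numeral_eq_Suc abs_mult_self_eq)
    moreover have "(d\<^sup>2 * u)\<^sup>2 = d ^ 4 * u\<^sup>2"
      by (simp add: power_mult_distrib)
    ultimately show ?thesis using d by simp
  qed
  also have "exp (- (u\<^sup>2 / (72 * (1 + (d\<^sup>2 * \<bar>u\<bar>) * \<bar>u\<bar>)))) \<le> exp (1/360 - 1/360 * \<bar>u\<bar>)"
  proof -
    have "d\<^sup>2 * \<bar>u\<bar> \<le> 4" using u pi_less_4 by (simp add: abs_mult)
    then have le: "1 + (d\<^sup>2 * \<bar>u\<bar>) * \<bar>u\<bar> \<le> 1 + 4 * \<bar>u\<bar>"
      by (intro add_left_mono mult_right_mono) auto
    have "(\<bar>u\<bar> - 1) * (1 + 4 * \<bar>u\<bar>) \<le> 5 * u\<^sup>2"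
    proof -
      have "(\<bar>u\<bar> - 1) * (1 + 4 * \<bar>u\<bar>) = 4 * \<bar>u\<bar>\<^sup>2 - 3 * \<bar>u\<bar> - 1"
        by (simp add: algebra_simps power2_eq_square del: abs_mult_self_eq)
      then show ?thesis
        using zero_le_power2[of u] abs_ge_zero[of u] by (simp only: power2_abs)
    qed
    then have "(\<bar>u\<bar> - 1) / 360 * (72 * (1 + 4 * \<bar>u\<bar>)) \<le> u\<^sup>2"
      by (simp add: field_simps)
    then have "(\<bar>u\<bar> - 1) / 360 \<le> u\<^sup>2 / (72 * (1 + 4 * \<bar>u\<bar>))"
      by (subst pos_le_divide_eq) (simp_all add: add_pos_nonneg)
    also have "\<dots> \<le> u\<^sup>2 / (72 * (1 + (d\<^sup>2 * \<bar>u\<bar>) * \<bar>u\<bar>))"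
      using le by (intro divide_left_mono mult_left_mono mult_pos_pos) (auto intro!: add_pos_nonneg)
    finally show ?thesis by (simp add: field_simps)
  qed
  also have "\<dots> = exp (1/360) * exp (- (1/360 * \<bar>u\<bar>))"
    by (simp only: diff_conv_add_uminus exp_add)
  finally show ?thesis .
qed

subsection \<open>The scaled Cauchy integral\<close>

lemma integral_gaussian:
  fixes c :: real
  assumes "0 < c"
  shows "(LINT u|lborel. exp (- (c * u\<^sup>2))) = sqrt (pi / c)"
proof -
  define s where "s = sqrt (1 / (2 * c))"
  have s: "0 < s" "s\<^sup>2 = 1 / (2 * c)" using assms by (auto simp: s_def)
  have "exp (- (c * u\<^sup>2)) = sqrt (pi / c) * normal_density 0 s u" for u
    using assms by (simp add: normal_density_def s real_sqrt_divide field_simps)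
  then have "(LINT u|lborel. exp (- (c * u\<^sup>2))) = sqrt (pi / c) * (LINT u|lborel. normal_density 0 s u)"
    by simp
  then show ?thesis using s by simp
qed

text \<open>The Cauchy integrand of Q alone in the scaled angle, normalised by the value on the
  positive axis and cut off to one full turn. The remaining prefactor is
  \<open>circle_scale\<close>, which cancels on division by q(n).\<close>

definition circle_kernel :: "real \<Rightarrow> nat \<Rightarrow> real \<Rightarrow> complex" where
  "circle_kernel d n u = indicator {-pi..pi} (d\<^sup>2 * u) *\<^sub>R
     (Q (of_real (exp (- d)) * cis (d\<^sup>2 * u)) / Q (of_real (exp (- d))) * cis (- (real n * (d\<^sup>2 * u))))"

definition circle_scale :: "real \<Rightarrow> nat \<Rightarrow> complex" where
  "circle_scale d n = of_real (d\<^sup>2 / (2 * pi * exp (- d) ^ n)) * Q (of_real (exp (- d)))"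

lemma circle_scale_nonzero: "0 < d \<Longrightarrow> circle_scale d n \<noteq> 0"
  using Q_nonzero[of "of_real (exp (- d))"] by (simp add: circle_scale_def)

lemma ps_coeff_Q_mult:
  assumes f: "f holomorphic_on ball 0 1" and d: "0 < d"
  shows "ps_coeff n (\<lambda>x. Q x * f x)
    = circle_scale d n * (LINT u|lborel. circle_kernel d n u * f (of_real (exp (- d)) * cis (d\<^sup>2 * u)))"
proof -
  define r where "r = exp (- d)"
  have r: "0 < r" "r < 1" using d by (auto simp: r_def)
  have Q0: "Q (of_real r) \<noteq> 0" using r by (intro Q_nonzero) simp
  have "(\<lambda>x. Q x * f x) holomorphic_on ball 0 1"
    by (intro holomorphic_intros holomorphic_Q f)
  from ps_coeff_eq_integral[OF this r, of "d\<^sup>2" n]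
  have "of_real (2 * pi * r ^ n) * ps_coeff n (\<lambda>x. Q x * f x) = of_real (d\<^sup>2) *
      (LINT u|lborel. Q (of_real r) * (circle_kernel d n u * f (of_real r * cis (d\<^sup>2 * u))))"
    using d Q0 by (simp add: circle_kernel_def r_def[symmetric] scaleR_conv_of_real mult_ac)
  also have "\<dots> = of_real (d\<^sup>2) * Q (of_real r) *
      (LINT u|lborel. circle_kernel d n u * f (of_real r * cis (d\<^sup>2 * u)))"
    by simp
  finally show ?thesis
    using r by (simp add: circle_scale_def r_def[symmetric] field_simps)
qed

lemma norm_circle_kernel_le:
  assumes "0 < d" "d \<le> 1"
  shows "norm (circle_kernel d n u) \<le> exp (1/360) * exp (- (1/360 * \<bar>u\<bar>))"
  using Q_ratio_le[OF assms, of u] by (auto simp: circle_kernel_def norm_mult norm_divide abs_le_iff split: split_indicator)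

lemma integrable_circle_kernel_mult:
  assumes f: "continuous_on (ball 0 1) f" and d: "0 < d"
  shows "integrable lborel (\<lambda>u. circle_kernel d n u * f (of_real (exp (- d)) * cis (d\<^sup>2 * u)))"
proof -
  define r where "r = exp (- d)"
  have r: "0 < r" "r < 1" using d by (auto simp: r_def)
  have Q0: "Q (of_real r) \<noteq> 0" using r by (intro Q_nonzero) simp
  have Qc: "continuous_on (ball 0 1) Q"
    by (rule holomorphic_on_imp_continuous_on[OF holomorphic_Q])
  have "integrable lborel (\<lambda>u. indicator {- pi / d\<^sup>2..pi / d\<^sup>2} u *\<^sub>R
     (Q (of_real r * cis (d\<^sup>2 * u)) / Q (of_real r) * cis (- (real n * (d\<^sup>2 * u)))
        * f (of_real r * cis (d\<^sup>2 * u))))"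
    using r Q0
    by (intro borel_integrable_compact compact_Icc continuous_intros
         continuous_on_compose2[OF f] continuous_on_compose2[OF Qc]) (auto simp: norm_mult)
  moreover have "indicator {- pi / d\<^sup>2..pi / d\<^sup>2} u = (indicator {-pi..pi} (d\<^sup>2 * u) :: real)" for u
    using d by (auto simp: field_simps split: split_indicator)
  ultimately show ?thesis
    by (simp add: circle_kernel_def r_def)
qed

text \<open>Dominated convergence to a Gaussian integral. The limit is positive, so q(n) has the
  exact order of \<open>circle_scale\<close>, and error terms can safely be divided by the kernel
  integral.\<close>

lemma circle_kernel_integral_tendsto:
  fixes d :: "nat \<Rightarrow> real" and m :: "nat \<Rightarrow> nat"
  assumes pos: "\<And>n. 0 < d n" and le1: "\<And>n. d n \<le> 1" and d0: "d \<longlonglongrightarrow> 0"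
    and saddle: "(\<lambda>n. 2 * zeta 3 / d n - real (m n) * d n ^ 2) \<longlonglongrightarrow> 0"
  shows "(\<lambda>n. LINT u|lborel. circle_kernel (d n) (m n) u) \<longlonglongrightarrow> of_real (sqrt (pi / (3 * zeta 3)))"
proof -
  have "(\<lambda>n. LINT u|lborel. circle_kernel (d n) (m n) u)
      \<longlonglongrightarrow> (LINT u|lborel. complex_of_real (exp (- (3 * zeta 3 * u\<^sup>2))))"
  proof (rule integral_dominated_convergence)
    show "integrable lborel (\<lambda>u::real. exp (1/360) * exp (- (1/360 * \<bar>u\<bar>)))"
      by (intro Bochner_Integration.integrable_mult_right integrable_exp_minus_abs) simp
    show "circle_kernel (d n) (m n) \<in> borel_measurable lborel" for n
      using integrable_circle_kernel_mult[of "\<lambda>_. 1" "d n" "m n"] pos[of n] by (simp add: borel_measurable_integrable)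
    show "AE u in lborel. norm (circle_kernel (d n) (m n) u) \<le> exp (1/360) * exp (- (1/360 * \<bar>u\<bar>))" for n
      using norm_circle_kernel_le[OF pos le1] by simp
    have "(\<lambda>n. circle_kernel (d n) (m n) u) \<longlonglongrightarrow> complex_of_real (exp (- (3 * zeta 3 * u\<^sup>2)))" for u
    proof (rule Lim_transform_eventually[OF Q_ratio_tendsto[OF pos d0 saddle, of u]])
      have "(\<lambda>n. d n ^ 2 * u) \<longlonglongrightarrow> 0 ^ 2 * u"
        by (intro tendsto_intros d0)
      \<comment> \<open>For fixed u the cutoff is eventually inactive, because the angle d^2 u tends
        to 0.\<close>
      then have "eventually (\<lambda>n. \<bar>d n ^ 2 * u\<bar> < pi) sequentially"
        by (intro order_tendstoD(2)[OF tendsto_rabs]) auto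
      then show "\<forall>\<^sub>F n in sequentially.
          Q (of_real (exp (- d n)) * cis (d n ^ 2 * u)) / Q (of_real (exp (- d n)))
               * cis (- (real (m n) * (d n ^ 2 * u))) = circle_kernel (d n) (m n) u"
        by eventually_elim (auto simp: circle_kernel_def split: split_indicator)
    qed
    then show "AE u in lborel. (\<lambda>n. circle_kernel (d n) (m n) u) \<longlonglongrightarrow> complex_of_real (exp (- (3 * zeta 3 * u\<^sup>2)))"
      by simp
  qed measurable
  also have "(LINT u|lborel. complex_of_real (exp (- (3 * zeta 3 * u\<^sup>2)))) = of_real (sqrt (pi / (3 * zeta 3)))"
    using zeta_3_pos by (simp only: integral_complex_of_real integral_gaussian)
  finally show ?thesis .
qed

text \<open>I1 and I2 are the contributions of F - F(e^{-d}) from angles up to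
  \<open>\<delta>\<close> and beyond. They are fixed before the bounds on F are chosen, so the same
  I1 can be tested against every tolerance.\<close>

lemma ps_coeff_Q_mult_split:
  assumes F: "F holomorphic_on ball 0 1" and d: "0 < d" "d \<le> 1" and \<delta>: "0 \<le> \<delta>"
  obtains I1 I2 where
    "ps_coeff n (\<lambda>x. Q x * F x) = circle_scale d n * (F (of_real (exp (- d))) * (LINT u|lborel. circle_kernel d n u) + I1 + I2)"
    "\<And>\<epsilon>. (\<And>\<theta>. \<bar>\<theta>\<bar> \<le> \<delta> \<Longrightarrow>
        norm (F (of_real (exp (- d)) * cis \<theta>) - F (of_real (exp (- d)))) \<le> \<epsilon>) \<Longrightarrow>
      norm I1 \<le> \<epsilon> * (LINT u|lborel. exp (1/360) * exp (- (1/360 * \<bar>u\<bar>)))"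
    "\<And>M. (\<And>\<theta>. norm (F (of_real (exp (- d)) * cis \<theta>)) \<le> M) \<Longrightarrow>
      norm I2 \<le> 2 * M * exp (- (\<delta>\<^sup>2 / (72 * d\<^sup>2 * (d\<^sup>2 + \<delta>\<^sup>2)))) * (2 * pi / d\<^sup>2)"
proof -
  define r where "r = complex_of_real (exp (- d))"
  have r: "norm r < 1" using d by (simp add: r_def)
  define G where "G = (\<lambda>u. F (r * cis (d\<^sup>2 * u)) - F r)"
  define S where "S = {u. \<bar>d\<^sup>2 * u\<bar> \<le> \<delta>}"
  define I1 where "I1 = (LINT u|lborel. indicator S u *\<^sub>R (circle_kernel d n u * G u))"
  define I2 where "I2 = (LINT u|lborel. indicator (-S) u *\<^sub>R (circle_kernel d n u * G u))"
  have S: "S \<in> sets lborel" "- S \<in> sets lborel" unfolding S_def by measurable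
  have Fc: "continuous_on (ball 0 1) F" by (rule holomorphic_on_imp_continuous_on[OF F])
  have iG: "integrable lborel (\<lambda>u. circle_kernel d n u * G u)"
    unfolding G_def r_def
    by (rule integrable_circle_kernel_mult[OF _ d(1), where f = "\<lambda>x. F x - F (of_real (exp (- d)))"])
       (intro continuous_intros Fc)
  have ik: "integrable lborel (\<lambda>u. circle_kernel d n u)"
    using integrable_circle_kernel_mult[of "\<lambda>_. 1" d n] d by simp
  have "(LINT u|lborel. circle_kernel d n u * F (r * cis (d\<^sup>2 * u)))
      = (LINT u|lborel. F r * circle_kernel d n u + (indicator S u *\<^sub>R (circle_kernel d n u * G u) + indicator (-S) u *\<^sub>R (circle_kernel d n u * G u)))"
    by (intro Bochner_Integration.integral_cong) (auto simp: G_def algebra_simps split: split_indicator)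
  also have "\<dots> = F r * (LINT u|lborel. circle_kernel d n u) + (I1 + I2)"
    unfolding I1_def I2_def using ik
    by (simp add: Bochner_Integration.integral_add integrable_mult_indicator[OF S(1) iG]
         integrable_mult_indicator[OF S(2) iG])
  finally have eq: "(LINT u|lborel. circle_kernel d n u * F (r * cis (d\<^sup>2 * u)))
      = F r * (LINT u|lborel. circle_kernel d n u) + (I1 + I2)" .
  have b1: "norm I1 \<le> \<epsilon> * (LINT u|lborel. exp (1/360) * exp (- (1/360 * \<bar>u\<bar>)))"
    if near: "\<And>\<theta>. \<bar>\<theta>\<bar> \<le> \<delta> \<Longrightarrow>
        norm (F (of_real (exp (- d)) * cis \<theta>) - F (of_real (exp (- d)))) \<le> \<epsilon>" for \<epsilon>
  proof -
    have \<epsilon>: "0 \<le> \<epsilon>" using near[of 0] \<delta> by simp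
    have "norm I1 \<le> (LINT u|lborel. norm (indicator S u *\<^sub>R (circle_kernel d n u * G u)))"
      unfolding I1_def by (rule integral_norm_bound)
    also have "\<dots> \<le> (LINT u|lborel. \<epsilon> * (exp (1/360) * exp (- (1/360 * \<bar>u\<bar>))))"
    proof (rule integral_mono')
      show "integrable lborel (\<lambda>u. \<epsilon> * (exp (1/360) * exp (- (1/360 * \<bar>u\<bar>))))"
        by (intro Bochner_Integration.integrable_mult_right integrable_exp_minus_abs) simp
      fix u :: real
      have "norm (circle_kernel d n u) * norm (G u) \<le> exp (1/360) * exp (- (1/360 * \<bar>u\<bar>)) * \<epsilon>" if "u \<in> S"
        using near[of "d\<^sup>2 * u"] that unfolding G_def r_def S_def
        by (intro mult_mono norm_circle_kernel_le d) auto
      then show "norm (indicator S u *\<^sub>R (circle_kernel d n u * G u)) \<le> \<epsilon> * (exp (1/360) * exp (- (1/360 * \<bar>u\<bar>)))"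
        using \<epsilon> by (auto simp: norm_mult mult_ac split: split_indicator)
    qed (use \<epsilon> in auto)
    finally show ?thesis by simp
  qed
  have b2: "norm I2 \<le> 2 * M * exp (- (\<delta>\<^sup>2 / (72 * d\<^sup>2 * (d\<^sup>2 + \<delta>\<^sup>2)))) * (2 * pi / d\<^sup>2)"
    if M: "\<And>\<theta>. norm (F (of_real (exp (- d)) * cis \<theta>)) \<le> M" for M
  proof -
    have M0: "0 \<le> M" using M[of 0] norm_ge_zero order_trans by blast
    define E where "E = (\<lambda>\<theta>. \<theta>\<^sup>2 / (72 * d\<^sup>2 * (d\<^sup>2 + \<theta>\<^sup>2)))"
    \<comment> \<open>The decay exponent increases with the absolute angle, so the whole far part is
      controlled by its value at the boundary angle.\<close>
    have mono: "E \<delta> \<le> E \<theta>" if "\<delta> \<le> \<bar>\<theta>\<bar>" for \<theta>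
    proof -
      have "\<delta>\<^sup>2 \<le> \<theta>\<^sup>2" using power_mono[OF that \<delta>, of 2] by simp
      then have "\<delta>\<^sup>2 * d\<^sup>2 \<le> \<theta>\<^sup>2 * d\<^sup>2" by (rule mult_right_mono) simp
      then have "\<delta>\<^sup>2 * (d\<^sup>2 + \<theta>\<^sup>2) \<le> \<theta>\<^sup>2 * (d\<^sup>2 + \<delta>\<^sup>2)"
        by (simp add: algebra_simps)
      then have "\<delta>\<^sup>2 / (d\<^sup>2 + \<delta>\<^sup>2) \<le> \<theta>\<^sup>2 / (d\<^sup>2 + \<theta>\<^sup>2)"
        using d by (simp add: pos_divide_le_eq pos_le_divide_eq add_pos_nonneg)
      then have "1 / (72 * d\<^sup>2) * (\<delta>\<^sup>2 / (d\<^sup>2 + \<delta>\<^sup>2)) \<le> 1 / (72 * d\<^sup>2) * (\<theta>\<^sup>2 / (d\<^sup>2 + \<theta>\<^sup>2))"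
        by (rule mult_left_mono) simp
      then show ?thesis by (simp add: E_def)
    qed
    define c where "c = exp (- E \<delta>) * (2 * M)"
    have "norm I2 \<le> (LINT u|lborel. norm (indicator (-S) u *\<^sub>R (circle_kernel d n u * G u)))"
      unfolding I2_def by (rule integral_norm_bound)
    also have "\<dots> \<le> (LINT u|lborel. indicator {- (pi / d\<^sup>2)..pi / d\<^sup>2} u *\<^sub>R c)"
    proof (rule integral_mono')
      show "integrable lborel (\<lambda>u. indicator {- (pi / d\<^sup>2)..pi / d\<^sup>2} u *\<^sub>R c)"
        by (intro borel_integrable_compact compact_Icc continuous_intros)
      fix u :: real
      have "norm (circle_kernel d n u) * norm (G u) \<le> c" if u: "u \<notin> S" "\<bar>d\<^sup>2 * u\<bar> \<le> pi"
        unfolding c_def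
      proof (intro mult_mono)
        have "norm (circle_kernel d n u) = norm (Q (of_real (exp (- d)) * cis (d\<^sup>2 * u)) / Q (of_real (exp (- d))))"
          using u by (simp add: circle_kernel_def norm_mult norm_divide abs_le_iff)
        also have "\<dots> \<le> exp (- E (d\<^sup>2 * u))"
          using norm_Q_le[OF d u(2)] Q_nonzero[OF r] unfolding E_def r_def
          by (simp add: norm_divide divide_le_eq mult.commute)
        also have "\<dots> \<le> exp (- E \<delta>)"
          using mono[of "d\<^sup>2 * u"] u(1) by (simp add: S_def)
        finally show "norm (circle_kernel d n u) \<le> exp (- E \<delta>)" .
        have "norm (G u) \<le> norm (F (r * cis (d\<^sup>2 * u))) + norm (F r)"
          unfolding G_def by (rule norm_triangle_ineq4)
        also have "\<dots> \<le> 2 * M"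
          using M[of "d\<^sup>2 * u"] M[of 0] by (simp add: r_def)
        finally show "norm (G u) \<le> 2 * M" .
      qed auto
      moreover have "circle_kernel d n u = 0" if "\<not> \<bar>d\<^sup>2 * u\<bar> \<le> pi"
        using that by (auto simp: circle_kernel_def split: split_indicator)
      moreover have "u \<in> {- (pi / d\<^sup>2)..pi / d\<^sup>2} \<longleftrightarrow> \<bar>d\<^sup>2 * u\<bar> \<le> pi"
        using d by (auto simp: abs_le_iff field_simps)
      moreover have "0 \<le> c" using M0 by (simp add: c_def)
      ultimately show "norm (indicator (-S) u *\<^sub>R (circle_kernel d n u * G u)) \<le> indicator {- (pi / d\<^sup>2)..pi / d\<^sup>2} u *\<^sub>R c"
        by (cases "\<bar>d\<^sup>2 * u\<bar> \<le> pi"; cases "u \<in> S") (auto simp: norm_mult)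
    qed (use M0 in \<open>auto simp: c_def\<close>)
    also have "\<dots> = c * (2 * pi / d\<^sup>2)"
      by (simp add: field_simps)
    finally show ?thesis unfolding c_def E_def by (simp add: mult_ac)
  qed
  show ?thesis
  proof (rule that[OF _ b1 b2])
    show "ps_coeff n (\<lambda>x. Q x * F x) = circle_scale d n * (F (of_real (exp (- d))) * (LINT u|lborel. circle_kernel d n u) + I1 + I2)"
      using ps_coeff_Q_mult[OF F d(1), of n] eq by (simp add: r_def add_ac)
  qed
qed

subsection \<open>The saddle point\<close>

text \<open>With t = n^{1/3} and y = t d the saddle-point defect is t (a^3 - y^3)/y, so it suffices
  that t (y - a) tends to 0. This holds because d differs from a/t by O(1/n).\<close>

lemma saddle_point_asymp:
  fixes d :: "nat \<Rightarrow> real" and \<beta> :: real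
  assumes \<beta>: "\<beta> > 0"
    and d: "(\<lambda>n. d n - ((2 * zeta 3 / real n) powr (1/3) - 1 / (36 * real n)))
              \<in> O(\<lambda>n. real n powr (- 1 - \<beta>))"
  defines "a \<equiv> (2 * zeta 3) powr (1/3)"
  shows "(\<lambda>n. real n powr (1/3) * d n) \<longlonglongrightarrow> a"
    and "d \<longlonglongrightarrow> 0"
    and "(\<lambda>n. 2 * zeta 3 / d n - real n * d n ^ 2) \<longlonglongrightarrow> 0"
proof -
  define t where "t = (\<lambda>n. real n powr (1/3))"
  define y where "y = (\<lambda>n. t n * d n)"
  have a: "0 < a" "a ^ 3 = 2 * zeta 3"
    using zeta_3_pos by (auto simp: a_def powr_power)
  obtain c where c: "eventually (\<lambda>n. norm (d n - ((2 * zeta 3 / real n) powr (1/3) - 1 / (36 * real n)))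
        \<le> c * norm (real n powr (- 1 - \<beta>))) sequentially"
    using landau_o.bigE[OF d] by blast
  \<comment> \<open>The summand 1 in the constant absorbs the correction 1/(36n), and c absorbs the
    error term of the hypothesis.\<close>
  have bound: "eventually (\<lambda>n. \<bar>t n * (y n - a)\<bar> \<le> (\<bar>c\<bar> + 1) * real n powr (-1/3)) sequentially"
    using c eventually_gt_at_top[of 0]
  proof eventually_elim
    case (elim n)
    define s where "s = (2 * zeta 3 / real n) powr (1/3)"
    have n: "real n \<ge> 1" using elim by simp
    have tn: "t n > 0" using elim by (simp add: t_def)
    have "s * t n = a"
      using elim zeta_3_pos by (simp add: s_def t_def a_def powr_divide)
    then have eq: "t n * (y n - a) = t n ^ 2 * (d n - s)"
      by (simp add: y_def power2_eq_square algebra_simps)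
    have "\<bar>d n - s\<bar> \<le> (\<bar>c\<bar> + 1) * real n powr (-1)"
    proof -
      have "\<bar>d n - (s - 1 / (36 * real n))\<bar> \<le> c * real n powr (- 1 - \<beta>)"
        using elim by (simp add: s_def)
      also have "\<dots> \<le> \<bar>c\<bar> * real n powr (-1)"
        using n \<beta> by (intro mult_mono powr_mono) auto
      finally have "\<bar>d n - (s - 1 / (36 * real n))\<bar> \<le> \<bar>c\<bar> * real n powr (-1)" .
      moreover have "1 / (36 * real n) \<le> real n powr (-1)" "0 \<le> 1 / (36 * real n)"
        using n by (auto simp: powr_minus field_simps)
      moreover have "(\<bar>c\<bar> + 1) * real n powr (-1) = \<bar>c\<bar> * real n powr (-1) + real n powr (-1)"
        by (rule distrib_right[where c = "real n powr (-1)" and b = 1, simplified mult_1_left])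
      ultimately show ?thesis by linarith
    qed
    then have le: "t n ^ 2 * \<bar>d n - s\<bar> \<le> t n ^ 2 * ((\<bar>c\<bar> + 1) * real n powr (-1))"
      by (rule mult_left_mono) simp
    have tt: "t n ^ 2 * real n powr (-1) = real n powr (-1/3)"
    proof -
      have "t n ^ 2 = real n powr (2/3)" using n by (simp add: t_def powr_power)
      then have "t n ^ 2 * real n powr (-1) = real n powr (2/3) * real n powr (-1)"
        by (simp only:)
      also have "\<dots> = real n powr (2/3 + -1)" by (rule powr_add[symmetric])
      finally show ?thesis by simp
    qed
    have "\<bar>t n * (y n - a)\<bar> = t n ^ 2 * \<bar>d n - s\<bar>"
      unfolding eq by (simp add: abs_mult)
    also have "\<dots> \<le> (\<bar>c\<bar> + 1) * (t n ^ 2 * real n powr (-1))"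
      using le by (simp only: mult_ac)
    finally show ?case unfolding tt .
  qed
  have lim: "(\<lambda>n. (\<bar>c\<bar> + 1) * real n powr (-1/3)) \<longlonglongrightarrow> 0"
    by real_asymp
  have ty: "(\<lambda>n. t n * (y n - a)) \<longlonglongrightarrow> 0"
    by (rule Lim_null_comparison[OF _ lim]) (use bound in \<open>simp only: real_norm_def\<close>)
  have ti: "(\<lambda>n. real n powr (-1/3)) \<longlonglongrightarrow> 0" by real_asymp
  have tpos: "eventually (\<lambda>n. t n > 0) sequentially"
    using eventually_gt_at_top[of 0] by eventually_elim (simp add: t_def)
  have "(\<lambda>n. t n * (y n - a) * real n powr (-1/3) + a) \<longlonglongrightarrow> 0 * 0 + a"
    by (intro tendsto_intros ty ti)
  then have "y \<longlonglongrightarrow> 0 * 0 + a"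
    by (rule Lim_transform_eventually)
       (use tpos in \<open>eventually_elim, simp add: t_def powr_minus field_simps\<close>)
  then have y: "y \<longlonglongrightarrow> a" by simp
  then show "(\<lambda>n. real n powr (1/3) * d n) \<longlonglongrightarrow> a"
    by (simp add: y_def t_def)
  have "(\<lambda>n. y n * real n powr (-1/3)) \<longlonglongrightarrow> a * 0"
    by (intro tendsto_intros y ti)
  then have "d \<longlonglongrightarrow> a * 0"
    by (rule Lim_transform_eventually)
       (use tpos in \<open>eventually_elim, simp add: y_def t_def powr_minus\<close>)
  then show "d \<longlonglongrightarrow> 0" by simp
  have ypos: "eventually (\<lambda>n. y n > 0) sequentially"
    by (rule order_tendstoD(1)[OF y a(1)])
  \<comment> \<open>Difference of cubes: y - a is split off from y^3 - a^3, and the other factor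
    stays bounded.\<close>
  have "(\<lambda>n. - (t n * (y n - a)) * (y n ^ 2 + y n * a + a ^ 2) / y n)
      \<longlonglongrightarrow> - 0 * (a ^ 2 + a * a + a ^ 2) / a"
    using a by (intro tendsto_intros ty y) auto
  then have "(\<lambda>n. 2 * zeta 3 / d n - real n * d n ^ 2) \<longlonglongrightarrow> - 0 * (a ^ 2 + a * a + a ^ 2) / a"
  proof (rule Lim_transform_eventually)
    show "\<forall>\<^sub>F n in sequentially. - (t n * (y n - a)) * (y n ^ 2 + y n * a + a ^ 2) / y n
       = 2 * zeta 3 / d n - real n * d n ^ 2"
      using tpos ypos
    proof eventually_elim
      case (elim n)
      have n: "real n = t n ^ 3" using elim by (simp add: t_def powr_power)
      have dn: "d n = y n / t n" using elim by (simp add: y_def)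
      show ?case
        unfolding n dn a(2)[symmetric] using elim
        by (simp add: field_simps power2_eq_square power3_eq_cube)
    qed
  qed
  then show "(\<lambda>n. 2 * zeta 3 / d n - real n * d n ^ 2) \<longlonglongrightarrow> 0" by simp
qed

section \<open>Exponents governing the far part of the circle\<close>

lemma tail_exponent_eventually:
  fixes c C \<gamma> :: real
  assumes "c > 0" "\<gamma> < 2/9"
  shows "\<forall>\<^sub>F n in sequentially. 2/3 * ln (real n) + C * real n powr \<gamma> \<le> c * real n powr (2/9) / (ln (real n))\<^sup>2"
proof -
  define e where "e = 2/9 - \<gamma>"
  have e: "e > 0" using assms by (simp add: e_def)
  \<comment> \<open>Both terms on the left of the claim are divided by n^{2/9}/log^2 n. They come
    from the arc length, of order d^{-2}, and from the growth of F.\<close>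
  have "(\<lambda>n. 2/3 * (ln (real n) ^ 3 * real n powr (-2/9)) + C * (ln (real n) ^ 2 * real n powr (- e)))
      \<longlonglongrightarrow> 2/3 * 0 + C * 0"
  proof (intro tendsto_intros)
    show "(\<lambda>n. ln (real n) ^ 3 * real n powr (-2/9)) \<longlonglongrightarrow> 0" by real_asymp
    show "(\<lambda>n. ln (real n) ^ 2 * real n powr (- e)) \<longlonglongrightarrow> 0" using e by real_asymp
  qed
  then have "\<forall>\<^sub>F n in sequentially.
      2/3 * (ln (real n) ^ 3 * real n powr (-2/9)) + C * (ln (real n) ^ 2 * real n powr (- e)) < c"
    using assms by (intro order_tendstoD(2)) auto
  then show ?thesis
    using eventually_gt_at_top[of 1]
  proof eventually_elim
    case (elim n)
    define l where "l = ln (real n)"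
    have l: "l > 0" using elim by (simp add: l_def)
    define v where "v = real n powr (2/9)"
    have v: "v > 0" using elim by (simp add: v_def)
    have g: "real n powr (-2/9) = 1 / v" "real n powr (- e) = real n powr \<gamma> / v"
      by (simp add: v_def powr_minus field_simps, simp add: v_def e_def powr_diff[symmetric])
    have "(2/3 * l ^ 3 + C * l ^ 2 * real n powr \<gamma>) / v \<le> c"
      using elim unfolding g l_def[symmetric] by (simp add: add_divide_distrib)
    then have "2/3 * l ^ 3 + C * l ^ 2 * real n powr \<gamma> \<le> c * v"
      using v by (simp add: pos_divide_le_eq)
    moreover have "(2/3 * l + C * real n powr \<gamma>) * l\<^sup>2 = 2/3 * l ^ 3 + C * l ^ 2 * real n powr \<gamma>"
      by (simp add: algebra_simps power2_eq_square power3_eq_cube)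
    ultimately show ?case
      unfolding l_def[symmetric] v_def[symmetric] using l by (subst pos_le_divide_eq) auto
  qed
qed

text \<open>Since \<open>\<delta>\<close> is at most d, the denominator is at most 144 d^4, while
  \<open>\<delta>\<close> squared is d^{10/3}/l^2. What remains is d^{-2/3}, which for d of order
  n^{-1/3} is the source of n^{2/9}.\<close>

lemma far_exponent_ge:
  fixes d l :: real
  assumes d: "0 < d" "d \<le> 1" and l: "1 \<le> l"
  defines "\<delta> \<equiv> d powr (5/3) / l"
  shows "d powr (-2/3) / (144 * l\<^sup>2) \<le> \<delta>\<^sup>2 / (72 * d\<^sup>2 * (d\<^sup>2 + \<delta>\<^sup>2))"
proof -
  have "d powr (5/3) / l \<le> d powr (5/3) / 1"
    using l by (intro divide_left_mono) auto
  also have "\<dots> \<le> d powr 1"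
    using d powr_mono'[of 1 "5/3" d] by simp
  finally have "\<delta> \<le> d" using d by (simp add: \<delta>_def)
  moreover have "0 < \<delta>" using d l by (simp add: \<delta>_def)
  ultimately have "\<delta>\<^sup>2 \<le> d\<^sup>2" by (intro power_mono) auto
  then have "\<delta>\<^sup>2 / (72 * d\<^sup>2 * (d\<^sup>2 + d\<^sup>2)) \<le> \<delta>\<^sup>2 / (72 * d\<^sup>2 * (d\<^sup>2 + \<delta>\<^sup>2))"
    using d by (intro divide_left_mono mult_left_mono add_left_mono mult_pos_pos add_pos_nonneg) auto
  moreover have "\<delta>\<^sup>2 / (72 * d\<^sup>2 * (d\<^sup>2 + d\<^sup>2)) = d powr (-2/3) / (144 * l\<^sup>2)"
  proof -
    have "(d powr (5/3))\<^sup>2 = d powr (10/3)" using d by (simp add: powr_power)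
    also have "\<dots> = d powr (-2/3) * d powr 4" by (simp add: powr_add[symmetric])
    also have "d powr 4 = d ^ 4" using d by simp
    finally have "\<delta>\<^sup>2 = d powr (-2/3) * d ^ 4 / l\<^sup>2"
      by (simp add: \<delta>_def power_divide)
    moreover have "72 * d\<^sup>2 * (d\<^sup>2 + d\<^sup>2) = 144 * d ^ 4" by (simp add: numeral_eq_Suc)
    ultimately show ?thesis using d by simp
  qed
  ultimately show ?thesis by simp
qed

text \<open>Converts the distance 1 - |x| in the growth condition (B) into a multiple of d.\<close>

lemma one_minus_exp_ge:
  fixes d :: real
  assumes "0 < d" "d \<le> 1"
  shows "d / 3 \<le> 1 - exp (- d)"
proof -
  have "exp d \<le> exp 1" using assms by simp
  also have "\<dots> \<le> 3" by (rule exp_le)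
  finally have "1 / 3 \<le> exp (- d)" by (simp add: exp_minus field_simps)
  moreover have "d \<le> exp d - 1"
    using exp_ge_add_one_self[of d] by linarith
  ultimately have "1 / 3 * d \<le> exp (- d) * (exp d - 1)"
    using assms by (intro mult_mono) auto
  then show ?thesis by (simp add: algebra_simps exp_minus)
qed

theorem theorem1:
  fixes d r \<delta> :: "nat \<Rightarrow> real" and \<beta> :: real and F :: "complex \<Rightarrow> complex"
  assumes \<beta>: "\<beta> > 0"
    and d: "(\<lambda>n. d n - ((2 * zeta 3 / real n) powr (1/3) - 1 / (36 * real n)))
              \<in> O(\<lambda>n. real n powr (- 1 - \<beta>))"
    and r: "\<And>n. r n = exp (- d n)"
    and \<delta>: "\<And>n. \<delta> n = d n powr (5/3) / ln (real n)"
    and F: "F analytic_on ball 0 1"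
    and A: "\<And>\<epsilon>. \<epsilon> > 0 \<Longrightarrow> \<forall>\<^sub>F n in sequentially. \<forall>\<theta>::real. \<bar>\<theta>\<bar> \<le> \<delta> n \<longrightarrow>
              norm (F (of_real (r n) * exp (\<i> * of_real \<theta>)) / F (of_real (r n)) - 1) < \<epsilon>"
    and B: "\<exists>C>0. \<exists>\<eta>\<in>{0<..<2/3}.
              F \<in> O[filtercomap norm (at_left 1)](\<lambda>x. of_real (exp (C / (1 - norm x) powr \<eta>)))"
  shows "\<exists>c>0. \<exists>e1 e2 :: nat \<Rightarrow> complex.
           e1 \<in> o(\<lambda>n. 1) \<and>
           e2 \<in> O(\<lambda>n. of_real (exp (- c * real n powr (2/9) / (ln (real n))\<^sup>2))) \<and>
           (\<forall>\<^sub>F n in sequentially.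
              1 / q n * ps_coeff n (\<lambda>x. Q x * F x)
                = F (of_real (exp (- d n))) * (1 + e1 n) + e2 n)"
proof -
  define a where "a = (2 * zeta 3) powr (1/3)"
  have a: "0 < a" using zeta_3_pos by (simp add: a_def)
  note lims = saddle_point_asymp[OF \<beta> d, folded a_def]
  define z where "z = (\<lambda>n. complex_of_real (exp (- d n)))"
  define J where "J = (\<lambda>n. LINT u|lborel. circle_kernel (d n) n u)"
  define \<kappa> where "\<kappa> = sqrt (pi / (3 * zeta 3))"
  define W where "W = (LINT u|lborel. exp (1/360) * exp (- (1/360 * \<bar>u::real\<bar>)))"
  have \<kappa>: "0 < \<kappa>" using zeta_3_pos by (simp add: \<kappa>_def)
  have W: "0 \<le> W" unfolding W_def by (intro integral_nonneg_AE) auto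
  have hol: "F holomorphic_on ball 0 1" by (rule analytic_imp_holomorphic[OF F])

  have "\<forall>\<^sub>F n in sequentially. real n powr (1/3) * d n > a / 2"
    by (rule order_tendstoD(1)[OF lims(1)]) (use a in simp)
  moreover have "\<forall>\<^sub>F n in sequentially. real n powr (1/3) * d n < 2 * a"
    by (rule order_tendstoD(2)[OF lims(1)]) (use a in simp)
  moreover have "\<forall>\<^sub>F n in sequentially. d n < 1"
    by (rule order_tendstoD(2)[OF lims(2)]) simp
  \<comment> \<open>The two-sided bound fixes the order n^{-1/3} of d, and n at least 3 ensures log
    n at least 1.\<close>
  ultimately have good: "\<forall>\<^sub>F n in sequentially. 0 < d n \<and> d n \<le> 1 \<and> 3 \<le> n
      \<and> a / 2 < real n powr (1/3) * d n \<and> real n powr (1/3) * d n < 2 * a"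
    using eventually_ge_at_top[of 3]
  proof eventually_elim
    case (elim n)
    have "0 < real n powr (1/3) * d n" using elim a by linarith
    then have "0 < d n" by (simp add: zero_less_mult_iff)
    then show ?case using elim by simp
  qed
  \<comment> \<open>The limit of the kernel integrals was proved for sequences lying in (0, 1]
    throughout, hence the shift by N and its later removal.\<close>
  then obtain N where N: "\<And>n. n \<ge> N \<Longrightarrow> 0 < d n \<and> d n \<le> 1"
    unfolding eventually_sequentially by blast
  have "(\<lambda>n. J (n + N)) \<longlonglongrightarrow> of_real \<kappa>"
    unfolding J_def \<kappa>_def
    using N LIMSEQ_ignore_initial_segment[OF lims(2), of N] LIMSEQ_ignore_initial_segment[OF lims(3), of N]
    by (intro circle_kernel_integral_tendsto) auto
  then have J: "J \<longlonglongrightarrow> of_real \<kappa>"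
    by (rule LIMSEQ_offset)
  have Jlow: "\<forall>\<^sub>F n in sequentially. norm (J n) > \<kappa> / 2"
    by (rule order_tendstoD(1)[OF tendsto_norm[OF J]]) (use \<kappa> in simp)

  have q: "q n = circle_scale (d n) n * J n" if "0 < d n" for n
    using ps_coeff_Q_mult[of "\<lambda>_. 1" "d n" n] that by (simp add: q_def J_def)

  \<comment> \<open>Packages the splitting, so that the two parts can be chosen as sequences in
    n.\<close>
  define P where "P = (\<lambda>n I1 I2.
      ps_coeff n (\<lambda>x. Q x * F x) = circle_scale (d n) n * (F (z n) * J n + I1 + I2) \<and>
      (\<forall>\<epsilon>. (\<forall>\<theta>. \<bar>\<theta>\<bar> \<le> \<delta> n \<longrightarrow> norm (F (z n * cis \<theta>) - F (z n)) \<le> \<epsilon>) \<longrightarrow> norm I1 \<le> \<epsilon> * W) \<and>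
      (\<forall>M. (\<forall>\<theta>. norm (F (z n * cis \<theta>)) \<le> M) \<longrightarrow>
         norm I2 \<le> 2 * M * exp (- ((\<delta> n)\<^sup>2 / (72 * (d n)\<^sup>2 * ((d n)\<^sup>2 + (\<delta> n)\<^sup>2)))) * (2 * pi / (d n)\<^sup>2)))"
  have "\<exists>I1 I2. (0 < d n \<and> d n \<le> 1 \<and> 3 \<le> n) \<longrightarrow> P n I1 I2" for n
  proof (cases "0 < d n \<and> d n \<le> 1 \<and> 3 \<le> n")
    case True
    have "0 \<le> \<delta> n" using True by (simp add: \<delta>)
    show ?thesis
    proof (rule ps_coeff_Q_mult_split[OF hol, of "d n" "\<delta> n" n], goal_cases)
      case (4 I1 I2)
      then have "P n I1 I2"
        unfolding P_def z_def J_def W_def by (intro conjI allI impI) simp_all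
      then show ?case by blast
    qed (use True \<open>0 \<le> \<delta> n\<close> in auto)
  qed auto
  then obtain I1 I2 where I: "\<And>n. 0 < d n \<and> d n \<le> 1 \<and> 3 \<le> n \<Longrightarrow> P n (I1 n) (I2 n)"
    by metis
  have near: "\<forall>\<^sub>F n in sequentially. F (z n) \<noteq> 0 \<and>
      (\<forall>\<theta>. \<bar>\<theta>\<bar> \<le> \<delta> n \<longrightarrow> norm (F (z n * cis \<theta>) - F (z n)) \<le> \<epsilon> * norm (F (z n)))"
    if \<epsilon>: "0 < \<epsilon>" for \<epsilon>
  proof -
    \<comment> \<open>A tolerance of at most 1 forces F(e^{-d}) to be nonzero: division by zero
      yields 0, and at angle 0 the quotient would then be at distance exactly 1 from 1.\<close>
    have "min \<epsilon> 1 > 0" using \<epsilon> by simp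
    from A[OF this] good show ?thesis
    proof eventually_elim
      case (elim n)
      have \<delta>0: "0 \<le> \<delta> n" using elim by (simp add: \<delta>)
      have *: "norm (F (z n * cis \<theta>) / F (z n) - 1) < min \<epsilon> 1" if "\<bar>\<theta>\<bar> \<le> \<delta> n" for \<theta>
        using elim(1) that by (simp add: r z_def cis_conv_exp)
      have nz: "F (z n) \<noteq> 0"
      proof
        assume "F (z n) = 0"
        then show False using *[of 0] \<delta>0 by simp
      qed
      have "norm (F (z n * cis \<theta>) - F (z n)) \<le> \<epsilon> * norm (F (z n))" if "\<bar>\<theta>\<bar> \<le> \<delta> n" for \<theta>
      proof -
        have "F (z n * cis \<theta>) - F (z n) = (F (z n * cis \<theta>) / F (z n) - 1) * F (z n)"
          using nz by (simp add: field_simps)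
        then have "norm (F (z n * cis \<theta>) - F (z n)) = norm (F (z n * cis \<theta>) / F (z n) - 1) * norm (F (z n))"
          by (simp only: norm_mult)
        also have "\<dots> \<le> \<epsilon> * norm (F (z n))"
          using *[OF that] by (intro mult_right_mono) auto
        finally show ?thesis .
      qed
      with nz show ?case by blast
    qed
  qed

  define e1 where "e1 = (\<lambda>n. I1 n / (J n * F (z n)))"
  define e2 where "e2 = (\<lambda>n. I2 n / J n)"
  have "e1 \<longlonglongrightarrow> 0"
  proof (rule tendstoI)
    fix \<epsilon> :: real assume \<epsilon>: "0 < \<epsilon>"
    \<comment> \<open>The kernel integral exceeds \<open>\<kappa> / 2\<close> in norm and W bounds
      the kernel mass; W + 1 makes the estimate strict even if W is 0.\<close>
    define \<epsilon>' where "\<epsilon>' = \<epsilon> * \<kappa> / (2 * (W + 1))"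
    have \<epsilon>': "0 < \<epsilon>'" using \<epsilon> \<kappa> W by (simp add: \<epsilon>'_def)
    show "\<forall>\<^sub>F n in sequentially. dist (e1 n) 0 < \<epsilon>"
      using near[OF \<epsilon>'] good Jlow
    proof eventually_elim
      case (elim n)
      have "norm (I1 n) \<le> \<epsilon>' * norm (F (z n)) * W"
        using I[of n] elim unfolding P_def by blast
      also have "\<dots> < \<epsilon>' * norm (F (z n)) * (W + 1)"
        using elim \<epsilon>' by simp
      also have "\<dots> = \<epsilon> * (\<kappa> / 2 * norm (F (z n)))"
        using W by (simp add: \<epsilon>'_def field_simps)
      also have "\<dots> \<le> \<epsilon> * (norm (J n) * norm (F (z n)))"
        using elim \<epsilon> by (intro mult_left_mono mult_right_mono) auto
      finally have "norm (I1 n) < \<epsilon> * (norm (J n) * norm (F (z n)))" .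
      moreover have "0 < norm (J n)" using elim \<kappa> by linarith
      then have "0 < norm (J n) * norm (F (z n))" using elim by simp
      ultimately show ?case
        by (simp add: e1_def norm_divide norm_mult pos_divide_less_eq)
    qed
  qed
  then have e1: "e1 \<in> o(\<lambda>n. 1)"
    by (intro smalloI_tendsto) auto

  obtain C \<eta> where C: "C > 0" and \<eta>: "0 < \<eta>" "\<eta> < 2/3"
    and bigF: "F \<in> O[filtercomap norm (at_left 1)](\<lambda>x. of_real (exp (C / (1 - norm x) powr \<eta>)))"
    using B by auto
  obtain K where K: "K > 0" "\<forall>\<^sub>F x in filtercomap norm (at_left 1).
      norm (F x) \<le> K * norm (of_real (exp (C / (1 - norm x) powr \<eta>)) :: complex)"
    using landau_o.bigE[OF bigF] by blast
  \<comment> \<open>R is a condition on the radius alone, so the bound on F holds uniformly on each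
    circle close to the unit circle.\<close>
  then obtain R where R: "eventually R (at_left 1)"
    "\<And>x. R (norm x) \<Longrightarrow> norm (F x) \<le> K * exp (C / (1 - norm x) powr \<eta>)"
    unfolding eventually_filtercomap by auto
  have "filterlim (\<lambda>n. exp (- d n)) (at_left 1) sequentially"
    unfolding filterlim_at
  proof
    show "\<forall>\<^sub>F n in sequentially. exp (- d n) \<in> {..<1} \<and> exp (- d n) \<noteq> 1"
      using good by eventually_elim auto
    have "(\<lambda>n. exp (- d n)) \<longlonglongrightarrow> exp (- 0)"
      by (intro tendsto_intros lims(2))
    then show "(\<lambda>n. exp (- d n)) \<longlonglongrightarrow> 1" by simp
  qed
  then have R': "\<forall>\<^sub>F n in sequentially. R (exp (- d n))"
    using R(1) by (simp add: filterlim_iff)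

  \<comment> \<open>\<open>c0\<close> comes from d at most 2a n^{-1/3} in
    \<open>far_exponent_ge\<close>, and \<open>C1\<close> from 1 - e^{-d} at least (a/6) n^{-1/3}. D
    collects 2/\<open>\<kappa>\<close> from the kernel integral, 2K from F and the constant in the
    arc length.\<close>
  define c0 where "c0 = (2 * a) powr (-2/3) / 144"
  have c0: "0 < c0" using a by (simp add: c0_def)
  define C1 where "C1 = C * (a / 6) powr (- \<eta>)"
  define v where "v = (\<lambda>n. real n powr (2/9) / (ln (real n))\<^sup>2)"
  define D where "D = 2 / \<kappa> * (2 * K * (2 * pi * (4 / a\<^sup>2)))"
  \<comment> \<open>Half of the decay rate is spent on absorbing the arc length and the growth of F;
    the other half is the final rate. The condition \<open>\<eta>\<close> < 2/3 enters as
    \<open>\<eta>\<close> / 3 < 2/9.\<close>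
  have tail: "\<forall>\<^sub>F n in sequentially. 2/3 * ln (real n) + C1 * real n powr (\<eta> / 3) \<le> c0 / 2 * v n"
    using tail_exponent_eventually[of "c0 / 2" "\<eta> / 3" C1] c0 \<eta> by (simp add: v_def)
  have "\<forall>\<^sub>F n in sequentially. norm (e2 n) \<le> D * exp (- (c0 / 2 * v n))"
    using tail R' good Jlow
  proof eventually_elim
    case (elim n)
    define t where "t = real n powr (1/3)"
    have n: "3 \<le> real n" using elim by simp
    have t: "0 < t" using elim by (simp add: t_def)
    have dn: "0 < d n" "d n \<le> 1" using elim by auto
    have dlow: "a / (2 * t) \<le> d n" and dup: "d n \<le> 2 * a / t"
      using elim t by (auto simp: t_def field_simps)
    have l: "1 \<le> ln (real n)"
      using n exp_le by (subst ln_ge_iff) auto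
    define M where "M = K * exp (C1 * real n powr (\<eta> / 3))"
    have M: "norm (F (z n * cis \<theta>)) \<le> M" for \<theta>
    proof -
      have "norm (z n * cis \<theta>) = exp (- d n)" by (simp add: z_def norm_mult)
      then have "norm (F (z n * cis \<theta>)) \<le> K * exp (C / (1 - exp (- d n)) powr \<eta>)"
        using R(2)[of "z n * cis \<theta>"] elim by simp
      also have "\<dots> \<le> M"
      proof -
        have "a / (2 * t) / 3 \<le> d n / 3" using dlow by simp
        also have "\<dots> \<le> 1 - exp (- d n)" by (rule one_minus_exp_ge[OF dn])
        finally have "a / 6 / t \<le> 1 - exp (- d n)" by (simp add: field_simps)
        then have "(1 - exp (- d n)) powr (- \<eta>) \<le> (a / 6 / t) powr (- \<eta>)"
          using a t \<eta> by (intro powr_mono2') auto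
        also have "\<dots> = (a / 6) powr (- \<eta>) * real n powr (\<eta> / 3)"
          using a n by (simp add: t_def powr_divide powr_mult powr_powr powr_minus field_simps)
        finally have "C * (1 - exp (- d n)) powr (- \<eta>) \<le> C1 * real n powr (\<eta> / 3)"
          using C by (simp add: C1_def)
        then have "C / (1 - exp (- d n)) powr \<eta> \<le> C1 * real n powr (\<eta> / 3)"
          by (simp only: powr_minus_divide[of "1 - exp (- d n)"] times_divide_eq_right mult_1_right)
        then show ?thesis
          unfolding M_def using K(1) by (intro mult_left_mono) auto
      qed
      finally show ?thesis .
    qed
    define E where "E = (\<delta> n)\<^sup>2 / (72 * (d n)\<^sup>2 * ((d n)\<^sup>2 + (\<delta> n)\<^sup>2))"
    have "norm (I2 n) \<le> 2 * M * exp (- E) * (2 * pi / (d n)\<^sup>2)"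
      using I[of n] elim M unfolding P_def E_def by blast
    also have "\<dots> \<le> 2 * M * exp (- (c0 * v n)) * (2 * pi * (4 / a\<^sup>2 * exp (2/3 * ln (real n))))"
    proof (intro mult_mono)
      have "c0 * v n = (2 * a / t) powr (-2/3) / (144 * (ln (real n))\<^sup>2)"
        using a n by (simp add: c0_def v_def t_def powr_divide powr_powr powr_minus field_simps)
      also have "\<dots> \<le> d n powr (-2/3) / (144 * (ln (real n))\<^sup>2)"
        using dup dn a t by (intro divide_right_mono powr_mono2') auto
      also have "\<dots> \<le> E"
        unfolding E_def \<delta> by (rule far_exponent_ge[OF dn l])
      finally show "exp (- E) \<le> exp (- (c0 * v n))" by simp
      have "(a / (2 * t))\<^sup>2 \<le> (d n)\<^sup>2"
        using dlow a t by (intro power_mono) auto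
      then have "2 * pi / (d n)\<^sup>2 \<le> 2 * pi / (a / (2 * t))\<^sup>2"
        using a t dn by (intro divide_left_mono) auto
      also have "\<dots> = 2 * pi * (4 / a\<^sup>2 * t\<^sup>2)"
        using a t by (simp add: field_simps power2_eq_square)
      \<comment> \<open>Written as an exponential so that all factors depending on n merge into the
        single exponent compared in \<open>tail\<close>.\<close>
      also have "t\<^sup>2 = exp (2/3 * ln (real n))"
        using n by (simp add: t_def powr_def exp_of_nat_mult[symmetric])
      finally show "2 * pi / (d n)\<^sup>2 \<le> 2 * pi * (4 / a\<^sup>2 * exp (2/3 * ln (real n)))" .
    qed (use K(1) in \<open>auto simp: M_def\<close>)
    also have "\<dots> = 2 * K * (2 * pi * (4 / a\<^sup>2)) *
        exp (2/3 * ln (real n) + C1 * real n powr (\<eta> / 3) - c0 * v n)"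
      unfolding M_def diff_conv_add_uminus exp_add by (simp only: mult_ac)
    also have "\<dots> \<le> 2 * K * (2 * pi * (4 / a\<^sup>2)) * exp (- (c0 / 2 * v n))"
      using elim(1) K(1) by (intro mult_left_mono) auto
    finally have "norm (I2 n) \<le> 2 * K * (2 * pi * (4 / a\<^sup>2)) * exp (- (c0 / 2 * v n))" .
    then have "norm (I2 n) / norm (J n) \<le> 2 * K * (2 * pi * (4 / a\<^sup>2)) * exp (- (c0 / 2 * v n)) / (\<kappa> / 2)"
      using elim \<kappa> K(1) by (intro frac_le) auto
    then show ?case
      by (simp add: e2_def norm_divide D_def field_simps)
  qed
  then have e2: "e2 \<in> O(\<lambda>n. of_real (exp (- (c0 / 2) * real n powr (2/9) / (ln (real n))\<^sup>2)))"
    by (intro bigoI[where c = D]) (simp add: v_def)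
  have "\<forall>\<^sub>F n in sequentially.
      1 / q n * ps_coeff n (\<lambda>x. Q x * F x) = F (of_real (exp (- d n))) * (1 + e1 n) + e2 n"
    \<comment> \<open>Only the nonvanishing of F(e^{-d}) is taken from \<open>near\<close>
      here.\<close>
    using near[of 1, simplified] good Jlow
  proof eventually_elim
    case (elim n)
    have nz: "J n \<noteq> 0" "F (z n) \<noteq> 0" "circle_scale (d n) n \<noteq> 0"
      using elim \<kappa> circle_scale_nonzero[of "d n" n] by auto
    have p: "ps_coeff n (\<lambda>x. Q x * F x) = circle_scale (d n) n * (F (z n) * J n + I1 n + I2 n)"
      using I[of n] elim unfolding P_def by blast
    have "q n = circle_scale (d n) n * J n" using q elim by simp
    moreover have "of_real (exp (- d n)) = z n" by (simp add: z_def)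
    ultimately show ?case
      using p nz by (simp add: e1_def e2_def field_simps)
  qed
  with e1 e2 c0 show ?thesis
    by (intro exI[of _ "c0 / 2"] conjI exI[of _ e1] exI[of _ e2]) auto
qed

end
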